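(* Let $\mathcal H=\mathcal H_0\times\mathcal H_0$ with $\mathcal H_0$ a Hilbert space, and let $N=\begin{pmatrix}0&I_{\mathcal H_0}\\0&0\end{pmatrix}\in\mathcal B(\mathcal H)$. Let $b\in\mathcal O_N$ and let $x\in(T\mathcal O_N)_b$ be an anti-symmetric tangent vector with $\|x\|_b<\pi/2$. Then there exists a curve of the form $\gamma(t)=e^{tz_0}be^{-tz_0}$ in $\mathcal O_N$, with $z_0\in\mathcal K(\mathcal H)_{ah}$ a minimal lifting of $x$, which verifies $\gamma(0)=b$, $\dot\gamma(0)=x$, and such that $\gamma$ is minimal for $|t|\le 1$; that is, for every $t_0$ with $|t_0|\le1$ the arc of $\gamma$ between $0$ and $t_0$ has length at most that of any piecewise smooth curve in $\mathcal O_N$ joining $b$ and $\gamma(t_0)$.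
   Context: $\mathcal K(\mathcal H)$ are the compact operators, $\mathcal K(\mathcal H)_{ah}$ the anti-hermitian ones, $\|\cdot\|$ the operator norm, $U_c(\mathcal H)=\{u\text{ unitary}: u-1\in\mathcal K(\mathcal H)\}$, and $\mathcal O_N=\{uNu^*: u\in U_c(\mathcal H)\}$, a submanifold of $N+\mathcal K(\mathcal H)$. For $b\in\mathcal O_N$ let $\delta_b:\mathcal K(\mathcal H)_{ah}\to\mathcal K(\mathcal H)$, $\delta_b(a)=ab-ba$; the tangent space $(T\mathcal O_N)_b$ is the range of $\delta_b$, with the Finsler norm $\|x\|_b=\inf\{\|z\|: z\in\mathcal K(\mathcal H)_{ah},\ \delta_b(z)=x\}$. A minimal lifting of $x$ is $z_0\in\mathcal K(\mathcal H)_{ah}$ with $\delta_b(z_0)=x$ and $\|z_0\|=\|x\|_b$. A tangent vector at $N$ has the matrix form $x=\begin{pmatrix}x_0&x_1\\0&-x_0\end{pmatrix}$ with $x_0,x_1\in\mathcal K(\mathcal H_0)$, $x_1^*=-x_1$; it is called anti-symmetric if also $x_0^*=-x_0$. A tangent vector $x$ at $b=uNu^*$ ($u\in U_c(\mathcal H)$) is anti-symmetric if $u^*xu$ is anti-symmetric at $N$ (this does not depend on $u$). Smooth curves are $C^1$ with non-vanishing derivative; the length of a piecewise smooth curve $\gamma$ in $\mathcal O_N$ is $\int\|\dot\gamma(t)\|_{\gamma(t)}\,dt$. *)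

theory Defs
  imports "HOL-Analysis.Analysis"
begin

section \<open>Complex Hilbert spaces\<close>

text \<open>A complex Hilbert space: the real inner product underlying the norm is the real part of a
  Hermitian form, linear in the first argument. Positivity of the form and its compatibility with
  the norm come from \<^class>\<open>real_inner\<close>.\<close>

class complex_hilbert_space = real_inner + complete_space +
  fixes scaleC :: "complex \<Rightarrow> 'a \<Rightarrow> 'a" (infixr \<open>*\<^sub>C\<close> 75)
    and cinner :: "'a \<Rightarrow> 'a \<Rightarrow> complex"
  assumes scaleC_add_right: "c *\<^sub>C (x + y) = c *\<^sub>C x + c *\<^sub>C y"
    and scaleC_add_left: "(c + d) *\<^sub>C x = c *\<^sub>C x + d *\<^sub>C x"
    and scaleC_scaleC: "c *\<^sub>C (d *\<^sub>C x) = (c * d) *\<^sub>C x"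
    and scaleC_of_real: "complex_of_real r *\<^sub>C x = r *\<^sub>R x"
    and cinner_commute: "cinner x y = cnj (cinner y x)"
    and cinner_add_left: "cinner (x + y) z = cinner x z + cinner y z"
    and cinner_scaleC_left: "cinner (c *\<^sub>C x) y = c * cinner x y"
    and Re_cinner: "Re (cinner x y) = inner x y"

instantiation complex :: complex_hilbert_space
begin

definition scaleC_complex :: "complex \<Rightarrow> complex \<Rightarrow> complex" where
  "scaleC_complex c x = c * x"

definition cinner_complex :: "complex \<Rightarrow> complex \<Rightarrow> complex" where
  "cinner_complex x y = x * cnj y"

instance
  by standard
    (auto simp: scaleC_complex_def cinner_complex_def algebra_simps scaleR_conv_of_real
      inner_complex_def)

end

instantiation prod :: (complex_hilbert_space, complex_hilbert_space) complex_hilbert_space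
begin

definition scaleC_prod :: "complex \<Rightarrow> 'a \<times> 'b \<Rightarrow> 'a \<times> 'b" where
  "scaleC_prod c x = (c *\<^sub>C fst x, c *\<^sub>C snd x)"

definition cinner_prod :: "'a \<times> 'b \<Rightarrow> 'a \<times> 'b \<Rightarrow> complex" where
  "cinner_prod x y = cinner (fst x) (fst y) + cinner (snd x) (snd y)"

instance
proof
  fix x y :: "'a \<times> 'b"
  show "cinner x y = cnj (cinner y x)"
    unfolding cinner_prod_def complex_cnj_add
    by (simp add: cinner_commute[symmetric])
qed (auto simp: scaleC_prod_def cinner_prod_def scaleC_add_right scaleC_add_left scaleC_scaleC
      scaleC_of_real cinner_add_left cinner_scaleC_left Re_cinner inner_prod_def algebra_simps
      prod_eq_iff)

end

section \<open>Operators\<close>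

text \<open>Elements of \<open>'h \<Rightarrow>\<^sub>L 'h\<close> are bounded and real-linear; complex linearity is imposed by
  \<open>cbounded\<close>. The norm of \<open>'h \<Rightarrow>\<^sub>L 'h\<close> is the operator norm.\<close>

definition cbounded :: "('h::complex_hilbert_space \<Rightarrow>\<^sub>L 'h) set" where
  "cbounded = {A. \<forall>c v. blinfun_apply A (c *\<^sub>C v) = c *\<^sub>C A v}"

definition adj :: "('h::complex_hilbert_space \<Rightarrow>\<^sub>L 'h) \<Rightarrow> ('h \<Rightarrow>\<^sub>L 'h)" where
  "adj A = (THE B. \<forall>v w. cinner (A v) w = cinner v (blinfun_apply B w))"

definition compact_ops :: "('h::complex_hilbert_space \<Rightarrow>\<^sub>L 'h) set" where
  "compact_ops = {A \<in> cbounded. compact (closure (blinfun_apply A ` cball 0 1))}"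

definition compact_ah :: "('h::complex_hilbert_space \<Rightarrow>\<^sub>L 'h) set" where
  "compact_ah = {A \<in> compact_ops. adj A = - A}"

definition unitary :: "('h::complex_hilbert_space \<Rightarrow>\<^sub>L 'h) \<Rightarrow> bool" where
  "unitary u \<longleftrightarrow> u \<in> cbounded \<and> adj u o\<^sub>L u = id_blinfun \<and> u o\<^sub>L adj u = id_blinfun"

definition U_c :: "('h::complex_hilbert_space \<Rightarrow>\<^sub>L 'h) set" where
  "U_c = {u. unitary u \<and> u - id_blinfun \<in> compact_ops}"

text \<open>The library function \<^const>\<open>exp\<close> needs a Banach algebra with a unit of norm 1, hence a type
  class which \<open>'h \<Rightarrow>\<^sub>L 'h\<close> is not an instance of (it excludes the zero space).\<close>

definition op_exp :: "('h::complex_hilbert_space \<Rightarrow>\<^sub>L 'h) \<Rightarrow> ('h \<Rightarrow>\<^sub>L 'h)" where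
  "op_exp A = (\<Sum>n. (((o\<^sub>L) A) ^^ n) id_blinfun /\<^sub>R fact n)"

definition block ::
  "('a::complex_hilbert_space \<Rightarrow>\<^sub>L 'a) \<Rightarrow> ('a \<Rightarrow>\<^sub>L 'a) \<Rightarrow> ('a \<Rightarrow>\<^sub>L 'a) \<Rightarrow> ('a \<Rightarrow>\<^sub>L 'a)
    \<Rightarrow> (('a \<times> 'a) \<Rightarrow>\<^sub>L ('a \<times> 'a))" where
  "block A B C D = Blinfun (\<lambda>(v, w). (A v + B w, C v + D w))"

lemma blinfun_apply_block [simp]: "block A B C D (v, w) = (A v + B w, C v + D w)"
proof -
  have "bounded_linear (\<lambda>z. (A (fst z) + B (snd z), C (fst z) + D (snd z)))"
    by (intro bounded_linear_Pair bounded_linear_add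
        blinfun.bounded_linear_right[THEN bounded_linear_compose]
        bounded_linear_fst bounded_linear_snd)
  then show ?thesis
    by (simp add: block_def bounded_linear_Blinfun_apply case_prod_unfold)
qed

section \<open>The orbit of \<open>N\<close>\<close>

definition N :: "('a::complex_hilbert_space \<times> 'a) \<Rightarrow>\<^sub>L ('a \<times> 'a)" where
  "N = block 0 id_blinfun 0 0"

definition orbit_N :: "(('a::complex_hilbert_space \<times> 'a) \<Rightarrow>\<^sub>L ('a \<times> 'a)) set" where
  "orbit_N = {u o\<^sub>L N o\<^sub>L adj u | u. u \<in> U_c}"

definition delta :: "('h::complex_hilbert_space \<Rightarrow>\<^sub>L 'h) \<Rightarrow> ('h \<Rightarrow>\<^sub>L 'h) \<Rightarrow> ('h \<Rightarrow>\<^sub>L 'h)" where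
  "delta b a = (a o\<^sub>L b) - (b o\<^sub>L a)"

definition tangent_space :: "('h::complex_hilbert_space \<Rightarrow>\<^sub>L 'h) \<Rightarrow> ('h \<Rightarrow>\<^sub>L 'h) set" where
  "tangent_space b = delta b ` compact_ah"

definition finsler_norm :: "('h::complex_hilbert_space \<Rightarrow>\<^sub>L 'h) \<Rightarrow> ('h \<Rightarrow>\<^sub>L 'h) \<Rightarrow> real" where
  "finsler_norm b x = Inf {norm z | z. z \<in> compact_ah \<and> delta b z = x}"

definition minimal_lifting ::
  "('h::complex_hilbert_space \<Rightarrow>\<^sub>L 'h) \<Rightarrow> ('h \<Rightarrow>\<^sub>L 'h) \<Rightarrow> ('h \<Rightarrow>\<^sub>L 'h) \<Rightarrow> bool" where
  "minimal_lifting b x z \<longleftrightarrow> z \<in> compact_ah \<and> delta b z = x \<and> norm z = finsler_norm b x"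

definition antisymmetric_at_N :: "(('a::complex_hilbert_space \<times> 'a) \<Rightarrow>\<^sub>L ('a \<times> 'a)) \<Rightarrow> bool" where
  "antisymmetric_at_N x \<longleftrightarrow> x \<in> tangent_space N \<and>
    (\<exists>x0 x1. x0 \<in> compact_ops \<and> x1 \<in> compact_ops \<and> adj x1 = - x1 \<and> adj x0 = - x0 \<and>
      x = block x0 x1 0 (- x0))"

definition antisymmetric_at ::
  "(('a::complex_hilbert_space \<times> 'a) \<Rightarrow>\<^sub>L ('a \<times> 'a)) \<Rightarrow> (('a \<times> 'a) \<Rightarrow>\<^sub>L ('a \<times> 'a)) \<Rightarrow> bool" where
  "antisymmetric_at b x \<longleftrightarrow> x \<in> tangent_space b \<and>
    (\<exists>u \<in> U_c. b = u o\<^sub>L N o\<^sub>L adj u \<and> antisymmetric_at_N (adj u o\<^sub>L x o\<^sub>L u))"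

section \<open>Curves\<close>

text \<open>As the orbit is a submanifold of \<open>N + compact_ops\<close>, a curve in it is \<open>C\<^sup>1\<close> iff it is so for the
  operator norm. Derivatives are one-sided at the ends of the parameter interval.\<close>

definition smooth_curve_on :: "real \<Rightarrow> real \<Rightarrow> (real \<Rightarrow> 'e::real_normed_vector) \<Rightarrow> bool" where
  "smooth_curve_on a b \<gamma> \<longleftrightarrow> a < b \<and>
    (\<exists>\<gamma>'. continuous_on {a..b} \<gamma>' \<and>
      (\<forall>t\<in>{a..b}. (\<gamma> has_vector_derivative \<gamma>' t) (at t within {a..b}) \<and> \<gamma>' t \<noteq> 0))"

definition piecewise_smooth_curve_on ::
  "real \<Rightarrow> real \<Rightarrow> (real \<Rightarrow> 'e::real_normed_vector) \<Rightarrow> bool" where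
  "piecewise_smooth_curve_on a b \<gamma> \<longleftrightarrow>
    (\<exists>n p. 0 < n \<and> p 0 = a \<and> p n = b \<and> (\<forall>i<n. smooth_curve_on (p i) (p (Suc i)) \<gamma>))"

text \<open>At the finitely many corners of a piecewise smooth curve the integrand is irrelevant.\<close>

definition curve_length ::
  "real \<Rightarrow> real \<Rightarrow> (real \<Rightarrow> ('h::complex_hilbert_space \<Rightarrow>\<^sub>L 'h)) \<Rightarrow> real" where
  "curve_length a b \<gamma> =
    integral {a..b} (\<lambda>t. finsler_norm (\<gamma> t) (vector_derivative \<gamma> (at t within {a..b})))"

end

theory Submission
  imports Defs
begin

text \<open>
  For a point \<open>b\<close> of the orbit put \<open>J\<^sub>b = b - b\<^sup>*\<close>. As \<open>b\<close> is unitarily equivalent to \<open>N\<close>, it satisfies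
  \<open>b b = 0\<close> and \<open>b b\<^sup>* + b\<^sup>* b = 1\<close>, so that \<open>J\<^sub>b\<close> is skew-adjoint and unitary with square \<open>-1\<close>. The real-linear map
  that takes \<open>b\<close> to \<open>J\<^sub>b\<close> compares the orbit with a symmetric space, where length can be measured on
  single vectors.

  An anti-symmetric tangent vector at \<open>b\<close> has a lifting \<open>z\<^sub>0\<close> that anticommutes with \<open>J\<^sub>b\<close>
  (\<open>antisymmetric_anticommuting_lifting\<close>). Any other lifting differs from \<open>z\<^sub>0\<close> by an operator that commutes with \<open>J\<^sub>b\<close>,
  so averaging over conjugation by \<open>J\<^sub>b\<close> shows that \<open>z\<^sub>0\<close> is minimal (\<open>anticommuting_lifting_minimal\<close>).
  Since \<open>z\<^sub>0\<close> lifts the velocity of \<open>\<gamma> t = exp (t z\<^sub>0) b exp (- t z\<^sub>0)\<close> at every time, the arc from \<open>0\<close> to \<open>t\<^sub>0\<close> has length at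
  most \<open>\<bar>t\<^sub>0\<bar> \<parallel>z\<^sub>0\<parallel>\<close>.

  It remains to bound the length of a competitor \<open>\<beta>\<close> from below. If \<open>z\<close> lifts the velocity of \<open>\<beta>\<close>, then \<open>J\<^sub>\<beta>\<close> moves with
  velocity \<open>z J\<^sub>\<beta> - J\<^sub>\<beta> z\<close>, of norm at most \<open>2 \<parallel>z\<parallel>\<close>; so the speed of \<open>J\<^sub>\<beta>\<close> is at most twice the Finsler speed of \<open>\<beta>\<close>
  (\<open>skew_part_speed\<close>). As \<open>z\<^sub>0\<close> is compact and skew-adjoint, there is a unit vector \<open>y\<close> with
  \<open>z\<^sub>0\<^sup>2 y = - \<parallel>z\<^sub>0\<parallel>\<^sup>2 y\<close> (\<open>compact_skew_maximal_vector\<close>), on which \<open>exp (s z\<^sub>0)\<close> acts as a rotation by \<open>s \<parallel>z\<^sub>0\<parallel>\<close>. Applying \<open>J\<^sub>\<beta>\<close> to the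
  vector \<open>- J\<^sub>b y\<close> gives a path on the unit sphere of the Hilbert space from \<open>y\<close> to \<open>exp (2 t\<^sub>0 z\<^sub>0) y\<close>, because \<open>z\<^sub>0\<close>
  anticommutes with \<open>J\<^sub>b\<close>. The angle between the end points is \<open>2 \<bar>t\<^sub>0\<bar> \<parallel>z\<^sub>0\<parallel> \<le> \<pi>\<close>, and a path on the sphere is at least as
  long as the angle between its end points (\<open>angle_le_length\<close>). Hence \<open>\<beta>\<close> has length at least
  \<open>\<bar>t\<^sub>0\<bar> \<parallel>z\<^sub>0\<parallel>\<close> (\<open>orbit_curve_minimal\<close>).

  For the length of \<open>\<beta>\<close> to mean what it should, its velocity must be tangent and its Finsler speed
  integrable. The first follows by differentiating the equations of the orbit, which yield an explicit lifting,
  polynomial in the point and the velocity (\<open>orbit_curve_tangent\<close>, \<open>tangent_lift_is_lifting\<close>); by means of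
  that lifting the Finsler speed is an infimum of continuous functions (\<open>finsler_norm_curve_integrable\<close>).
\<close>

section \<open>Adjoints\<close>

text \<open>The representing vector is the minimiser of \<open>\<parallel>v\<parallel>\<^sup>2 - 2 f v\<close>. It exists because, by the parallelogram
  identity, every minimising sequence is Cauchy, and the vanishing of the first variation there is the claim.\<close>

lemma riesz_representation:
  fixes f :: "'h::{real_inner,complete_space} \<Rightarrow> real"
  assumes "bounded_linear f"
  shows "\<exists>w. \<forall>v. f v = inner w v"
proof -
  interpret f: bounded_linear f by (rule assms)
  obtain K where K: "\<And>v. norm (f v) \<le> norm v * K"
    using f.bounded by blast
  define q where "q v = (norm v)\<^sup>2 - 2 * f v" for v
  have q_ge: "q v \<ge> - K\<^sup>2" for v
  proof -
    have "0 \<le> (norm v - K)\<^sup>2" by simp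
    also have "\<dots> = (norm v)\<^sup>2 - 2 * (norm v * K) + K\<^sup>2"
      by (simp add: power2_eq_square algebra_simps)
    also have "\<dots> \<le> q v + K\<^sup>2" using K[of v] by (simp add: q_def)
    finally show ?thesis by simp
  qed
  define m where "m = Inf (range q)"
  have bdd: "bdd_below (range q)"
    using q_ge by (auto intro!: bdd_belowI)
  have m_le: "m \<le> q v" for v
    unfolding m_def using bdd by (auto intro: cInf_lower)
  have "\<exists>v. q v < m + e" if "e > 0" for e
    using cInf_lessD[of "range q" "m + e"] that by (auto simp: m_def)
  then have "\<forall>n. \<exists>v. q v < m + inverse (real (Suc n))"
    by simp
  then obtain v where v: "\<And>n. q (v n) < m + inverse (real (Suc n))"
    by metis
  have par: "(norm (a - c))\<^sup>2 \<le> 2 * (q a + q c - 2 * m)" for a c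
  proof -
    have 1: "(norm (a - c))\<^sup>2 = 2 * (norm a)\<^sup>2 + 2 * (norm c)\<^sup>2 - (norm (a + c))\<^sup>2"
      unfolding power2_norm_eq_inner
      by (simp add: inner_diff_left inner_diff_right inner_add_left inner_add_right inner_commute)
    have 2: "(norm ((1/2) *\<^sub>R (a + c)))\<^sup>2 = (norm (a + c))\<^sup>2 / 4"
      unfolding norm_scaleR by (simp add: power_mult_distrib power_divide)
    have "q a + q c = 2 * q ((1/2) *\<^sub>R (a + c)) + (norm (a - c))\<^sup>2 / 2"
      unfolding q_def 1 2 f.scaleR f.add by (simp add: field_simps)
    then show ?thesis using m_le[of "(1/2) *\<^sub>R (a + c)"] by simp
  qed
  have "Cauchy v"
  proof (rule metric_CauchyI)
    fix e :: real assume "e > 0"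
    then have "e\<^sup>2 / 4 > 0" by simp
    then obtain M where M: "inverse (real (Suc M)) < e\<^sup>2 / 4"
      using reals_Archimedean by blast
    have "dist (v i) (v j) < e" if "i \<ge> M" "j \<ge> M" for i j
    proof -
      have "q (v k) - m < e\<^sup>2 / 4" if "k \<ge> M" for k
      proof -
        have "q (v k) - m < inverse (real (Suc k))" using v[of k] by linarith
        also have "\<dots> \<le> inverse (real (Suc M))"
          using that by (intro le_imp_inverse_le) auto
        finally show ?thesis using M by (rule less_trans)
      qed
      from this[OF that(1)] this[OF that(2)] have "2 * (q (v i) + q (v j) - 2 * m) < e\<^sup>2"
        by (simp add: field_simps)
      then have "(norm (v i - v j))\<^sup>2 < e\<^sup>2"
        using par[of "v i" "v j"] by (rule le_less_trans[rotated])
      then show ?thesis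
        using \<open>e > 0\<close> by (simp add: dist_norm power2_less_imp_less)
    qed
    then show "\<exists>M. \<forall>i\<ge>M. \<forall>j\<ge>M. dist (v i) (v j) < e" by blast
  qed
  then obtain w where w: "v \<longlonglongrightarrow> w"
    using Cauchy_convergent convergent_def by blast
  have "(\<lambda>n. q (v n)) \<longlonglongrightarrow> q w"
    unfolding q_def by (intro tendsto_intros f.tendsto w)
  moreover have "(\<lambda>n. m + inverse (real (Suc n))) \<longlonglongrightarrow> m + 0"
    by (intro tendsto_intros LIMSEQ_inverse_real_of_nat)
  ultimately have "q w \<le> m + 0"
    using v by (meson LIMSEQ_le less_imp_le)
  then have min: "q w \<le> q u" for u
    using m_le[of u] by simp
  have "f u = inner w u" for u
  proof -
    define r where "r = inner w u - f u"
    define t where "t = - r / ((norm u)\<^sup>2 + 1)"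
    have pos: "(norm u)\<^sup>2 + 1 > 0" by (simp add: add_nonneg_pos)
    have "q (w + t *\<^sub>R u) = q w + 2 * t * r + t\<^sup>2 * (norm u)\<^sup>2"
      unfolding q_def r_def f.add f.scaleR power2_norm_eq_inner
      by (simp add: inner_add_left inner_add_right inner_commute power2_eq_square algebra_simps)
    then have ge: "0 \<le> 2 * t * r + t\<^sup>2 * (norm u)\<^sup>2"
      using min[of "w + t *\<^sub>R u"] by simp
    have "t\<^sup>2 * (norm u)\<^sup>2 \<le> t\<^sup>2 * ((norm u)\<^sup>2 + 1)"
      by (simp add: mult_left_mono)
    also have "\<dots> = - t * r"
      using pos by (simp add: t_def power2_eq_square)
    finally have "0 \<le> t * r" using ge by simp
    also have "t * r = - (r\<^sup>2 / ((norm u)\<^sup>2 + 1))"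
      by (simp add: t_def power2_eq_square)
    finally have "r\<^sup>2 / ((norm u)\<^sup>2 + 1) \<le> 0" by simp
    then have "r\<^sup>2 \<le> 0" using pos by (simp add: divide_le_0_iff)
    then have "r = 0" by simp
    then show ?thesis by (simp add: r_def)
  qed
  then show ?thesis by blast
qed

text \<open>The constant \<^const>\<open>adj\<close> is determined only on complex-linear operators, hence it is not a linear map on
  all of \<open>'h \<Rightarrow>\<^sub>L 'h\<close> and cannot be differentiated as one. The adjoint for the real inner
  product is a bounded linear map on the whole space and coincides with \<^const>\<open>adj\<close> on
  \<^const>\<open>cbounded\<close>, so that all further work is done with it.\<close>

definition hilbert_adj ::
  "('h::{real_inner,complete_space} \<Rightarrow>\<^sub>L 'h) \<Rightarrow> ('h \<Rightarrow>\<^sub>L 'h)" where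
  "hilbert_adj A = (THE B. \<forall>v w. inner (A v) w = inner v (blinfun_apply B w))"

lemma hilbert_adj_eqI:
  fixes A B :: "'h::{real_inner,complete_space} \<Rightarrow>\<^sub>L 'h"
  assumes "\<And>v w. inner (A v) w = inner v (blinfun_apply B w)"
  shows "hilbert_adj A = B"
proof -
  have "C = B" if C: "\<forall>v w. inner (A v) w = inner v (blinfun_apply C w)" for C
  proof (rule blinfun_eqI)
    fix w
    have "\<forall>v. inner v (C w) = inner v (B w)" using C assms by metis
    then show "C w = B w" using vector_eq_ldot by blast
  qed
  moreover have "\<forall>v w. inner (A v) w = inner v (blinfun_apply B w)"
    using assms by blast
  ultimately show ?thesis unfolding hilbert_adj_def by (intro the_equality)
qed

lemma inner_hilbert_adj:
  fixes A :: "'h::{real_inner,complete_space} \<Rightarrow>\<^sub>L 'h"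
  shows "inner (A v) w = inner v (hilbert_adj A w)"
proof -
  have "\<exists>z. \<forall>v. inner (A v) w = inner v z" for w
  proof -
    have "bounded_linear (\<lambda>v. inner (A v) w)"
      by (intro bounded_linear_compose[OF bounded_linear_inner_left] blinfun.bounded_linear_right)
    then show ?thesis using riesz_representation by (simp add: inner_commute)
  qed
  then obtain B where B: "\<And>v w. inner (A v) w = inner v (B w)" by metis
  have "bounded_linear B"
  proof
    show "B (x + y) = B x + B y" for x y
      by (subst vector_eq_ldot[symmetric]) (simp add: B[symmetric] inner_add_right)
    show "B (r *\<^sub>R x) = r *\<^sub>R B x" for r x
      by (subst vector_eq_ldot[symmetric]) (simp add: B[symmetric])
    have "norm (B x) \<le> norm x * norm A" for x
    proof (cases "B x = 0")
      case False
      have "norm (B x) * norm (B x) = inner (A (B x)) x"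
        by (simp add: B power2_norm_eq_inner[symmetric] power2_eq_square)
      also have "\<dots> \<le> norm (A (B x)) * norm x" by (rule norm_cauchy_schwarz)
      also have "\<dots> \<le> (norm A * norm (B x)) * norm x"
        by (intro mult_right_mono norm_blinfun) simp
      finally show ?thesis using False by (simp add: mult_ac)
    qed simp
    then show "\<exists>K. \<forall>x. norm (B x) \<le> norm x * K" by blast
  qed
  then have "hilbert_adj A = Blinfun B"
    by (intro hilbert_adj_eqI) (simp add: bounded_linear_Blinfun_apply B)
  then show ?thesis
    using \<open>bounded_linear B\<close> by (simp add: bounded_linear_Blinfun_apply B)
qed

lemma inner_hilbert_adj':
  fixes A :: "'h::{real_inner,complete_space} \<Rightarrow>\<^sub>L 'h"
  shows "inner v (A w) = inner (hilbert_adj A v) w"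
  by (metis inner_commute inner_hilbert_adj)

lemma hilbert_adj_add: "hilbert_adj (A + B) = hilbert_adj A + hilbert_adj B"
  by (rule hilbert_adj_eqI)
    (simp add: blinfun.add_left inner_add_left inner_add_right inner_hilbert_adj)

lemma hilbert_adj_diff: "hilbert_adj (A - B) = hilbert_adj A - hilbert_adj B"
  by (rule hilbert_adj_eqI)
    (simp add: blinfun.diff_left inner_diff_left inner_diff_right inner_hilbert_adj)

lemma hilbert_adj_minus: "hilbert_adj (- A) = - hilbert_adj A"
  by (rule hilbert_adj_eqI) (simp add: blinfun.minus_left inner_hilbert_adj)

lemma hilbert_adj_scaleR: "hilbert_adj (r *\<^sub>R A) = r *\<^sub>R hilbert_adj A"
  by (rule hilbert_adj_eqI) (simp add: blinfun.scaleR_left inner_hilbert_adj)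

lemma hilbert_adj_compose: "hilbert_adj (A o\<^sub>L B) = hilbert_adj B o\<^sub>L hilbert_adj A"
  by (rule hilbert_adj_eqI) (simp add: inner_hilbert_adj)

lemma hilbert_adj_id: "hilbert_adj id_blinfun = id_blinfun"
  by (rule hilbert_adj_eqI) simp

lemma hilbert_adj_zero: "hilbert_adj 0 = 0"
  by (rule hilbert_adj_eqI) simp

lemma hilbert_adj_adj: "hilbert_adj (hilbert_adj A) = A"
  by (rule hilbert_adj_eqI) (metis inner_commute inner_hilbert_adj)

lemmas hilbert_adj_simps = hilbert_adj_add hilbert_adj_diff hilbert_adj_minus hilbert_adj_scaleR
  hilbert_adj_compose hilbert_adj_id hilbert_adj_zero hilbert_adj_adj

lemma norm_hilbert_adj_le: "norm (hilbert_adj A) \<le> norm A"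
proof (rule norm_blinfun_bound)
  fix w
  show "norm (hilbert_adj A w) \<le> norm A * norm w"
  proof (cases "hilbert_adj A w = 0")
    case False
    let ?u = "hilbert_adj A w"
    have "norm ?u * norm ?u = inner (A ?u) w"
      by (simp add: inner_hilbert_adj power2_norm_eq_inner[symmetric] power2_eq_square)
    also have "\<dots> \<le> norm (A ?u) * norm w" by (rule norm_cauchy_schwarz)
    also have "\<dots> \<le> (norm A * norm ?u) * norm w"
      by (intro mult_right_mono norm_blinfun) simp
    finally show ?thesis using False by (simp add: mult_ac)
  qed simp
qed simp

lemma bounded_linear_hilbert_adj: "bounded_linear hilbert_adj"
  by standard (auto simp: hilbert_adj_simps intro!: exI[of _ 1] norm_hilbert_adj_le)

section \<open>Complex-linear operators\<close>

lemma cboundedI: "(\<And>c v. blinfun_apply A (c *\<^sub>C v) = c *\<^sub>C A v) \<Longrightarrow> A \<in> cbounded"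
  by (simp add: cbounded_def)

lemma cboundedD: "A \<in> cbounded \<Longrightarrow> blinfun_apply A (c *\<^sub>C v) = c *\<^sub>C A v"
  by (simp add: cbounded_def)

lemma Im_cinner: "Im (cinner x y) = - inner (\<i> *\<^sub>C x) y"
  by (simp add: Re_cinner[symmetric] cinner_scaleC_left)

lemma cinner_eq_iff:
  "cinner x y = cinner x' y' \<longleftrightarrow>
    inner x y = inner x' y' \<and> inner (\<i> *\<^sub>C x) y = inner (\<i> *\<^sub>C x') y'"
  by (simp add: complex_eq_iff Re_cinner Im_cinner)

lemma cinner_hilbert_adj:
  assumes "A \<in> cbounded"
  shows "cinner (A v) w = cinner v (hilbert_adj A w)"
  by (simp add: cinner_eq_iff inner_hilbert_adj cboundedD[OF assms, symmetric])

lemma adj_eq_hilbert_adj: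
  assumes "A \<in> cbounded"
  shows "adj A = hilbert_adj A"
  unfolding adj_def
proof (rule the_equality)
  fix B assume "\<forall>v w. cinner (A v) w = cinner v (blinfun_apply B w)"
  then have "\<And>v w. inner (A v) w = inner v (blinfun_apply B w)"
    by (metis Re_cinner)
  then show "B = hilbert_adj A" using hilbert_adj_eqI by metis
qed (simp add: cinner_hilbert_adj assms)

lemma cbounded_hilbert_adj:
  assumes "A \<in> cbounded"
  shows "hilbert_adj A \<in> cbounded"
proof (rule cboundedI)
  fix c w
  have "inner v (hilbert_adj A (c *\<^sub>C w)) = inner v (c *\<^sub>C hilbert_adj A w)" for v
  proof -
    have "cinner v (hilbert_adj A (c *\<^sub>C w)) = cinner (A v) (c *\<^sub>C w)"
      by (simp add: cinner_hilbert_adj assms)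
    also have "\<dots> = cnj c * cinner (A v) w"
      by (subst (1 2) cinner_commute) (simp add: cinner_scaleC_left)
    also have "\<dots> = cinner v (c *\<^sub>C hilbert_adj A w)"
      unfolding cinner_hilbert_adj[OF assms]
      by (subst (1 2) cinner_commute) (simp add: cinner_scaleC_left)
    finally show ?thesis by (metis Re_cinner)
  qed
  then show "hilbert_adj A (c *\<^sub>C w) = c *\<^sub>C hilbert_adj A w"
    by (subst vector_eq_ldot[symmetric]) blast
qed

lemma cbounded_id: "id_blinfun \<in> cbounded"
  by (simp add: cbounded_def)

lemma scaleC_minus: "c *\<^sub>C (- v :: 'h::complex_hilbert_space) = - (c *\<^sub>C v)"
proof -
  have "c *\<^sub>C (-1 *\<^sub>R v) = -1 *\<^sub>R (c *\<^sub>C v)"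
    unfolding scaleC_of_real[symmetric] scaleC_scaleC by (simp add: mult.commute)
  then show ?thesis by simp
qed

lemma scaleC_scaleR: "c *\<^sub>C (r *\<^sub>R v :: 'h::complex_hilbert_space) = r *\<^sub>R (c *\<^sub>C v)"
  by (simp add: scaleC_of_real[symmetric] scaleC_scaleC mult.commute)

lemma scaleC_diff: "c *\<^sub>C (v - w :: 'h::complex_hilbert_space) = c *\<^sub>C v - c *\<^sub>C w"
  using scaleC_add_right[of c v "-w"] by (simp add: scaleC_minus)

lemma scaleC_zero: "c *\<^sub>C (0 :: 'h::complex_hilbert_space) = 0"
  using scaleC_diff[of c 0 0] by simp

lemma cbounded_add: "A \<in> cbounded \<Longrightarrow> B \<in> cbounded \<Longrightarrow> A + B \<in> cbounded"
  by (simp add: cbounded_def blinfun.add_left scaleC_add_right)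

lemma cbounded_scaleR: "A \<in> cbounded \<Longrightarrow> r *\<^sub>R A \<in> cbounded"
  by (simp add: cbounded_def blinfun.scaleR_left scaleC_scaleR)

lemma cbounded_zero: "0 \<in> cbounded"
  by (simp add: cbounded_def scaleC_zero)

lemma cbounded_compose: "A \<in> cbounded \<Longrightarrow> B \<in> cbounded \<Longrightarrow> A o\<^sub>L B \<in> cbounded"
  by (simp add: cbounded_def)

lemma bounded_linear_scaleC: "bounded_linear (\<lambda>v::'h::complex_hilbert_space. c *\<^sub>C v)"
proof
  have "norm (c *\<^sub>C v) \<le> norm v * cmod c" for v :: 'h
  proof -
    have "cinner (c *\<^sub>C v) (c *\<^sub>C v) = c * cnj c * cinner v v"
      unfolding cinner_scaleC_left
      by (subst cinner_commute) (simp add: cinner_scaleC_left cinner_commute[symmetric])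
    also have "c * cnj c = complex_of_real ((cmod c)\<^sup>2)"
      by (rule complex_norm_square[symmetric])
    finally have "inner (c *\<^sub>C v) (c *\<^sub>C v) = (cmod c)\<^sup>2 * inner v v"
      by (metis Re_cinner Re_complex_of_real scaleC_of_real cinner_scaleC_left inner_scaleR_left)
    then have "(norm (c *\<^sub>C v))\<^sup>2 = (cmod c * norm v)\<^sup>2"
      by (simp add: power2_norm_eq_inner power_mult_distrib)
    then have "norm (c *\<^sub>C v) = cmod c * norm v"
      by (simp add: power2_eq_iff_nonneg)
    then show ?thesis by (simp add: mult.commute)
  qed
  then show "\<exists>K. \<forall>v. norm (c *\<^sub>C v::'h) \<le> norm v * K" by blast
qed (simp_all add: scaleC_add_right scaleC_scaleR)

lemma closed_cbounded: "closed (cbounded :: ('h::complex_hilbert_space \<Rightarrow>\<^sub>L 'h) set)"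
unfolding closed_sequential_limits
proof (intro allI impI, elim conjE)
  fix A :: "nat \<Rightarrow> 'h \<Rightarrow>\<^sub>L 'h" and B
  assume A: "\<forall>n. A n \<in> cbounded" and lim: "A \<longlonglongrightarrow> B"
  have app: "(\<lambda>n. A n v) \<longlonglongrightarrow> B v" for v
    by (intro tendsto_intros lim)
  show "B \<in> cbounded"
  proof (rule cboundedI)
    fix c v
    have "(\<lambda>n. c *\<^sub>C A n v) \<longlonglongrightarrow> c *\<^sub>C B v"
      by (rule bounded_linear.tendsto[OF bounded_linear_scaleC app])
    moreover have "(\<lambda>n. c *\<^sub>C A n v) \<longlonglongrightarrow> B (c *\<^sub>C v)"
      using app[of "c *\<^sub>C v"] A by (simp add: cboundedD)
    ultimately show "B (c *\<^sub>C v) = c *\<^sub>C B v" using LIMSEQ_unique by blast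
  qed
qed

section \<open>Compact operators\<close>

lemma compact_ops_iff:
  "A \<in> compact_ops \<longleftrightarrow> A \<in> cbounded \<and> (\<exists>C. compact C \<and> blinfun_apply A ` cball 0 1 \<subseteq> C)"
  unfolding compact_ops_def
  using closure_subset compact_closure
  by (metis (no_types, lifting) bounded_subset closed_closure closure_minimal compact_Int_closed
      compact_imp_closed inf.absorb_iff2 mem_Collect_eq)

lemma compact_opsI:
  "A \<in> cbounded \<Longrightarrow> compact C \<Longrightarrow> (\<And>v. norm v \<le> 1 \<Longrightarrow> blinfun_apply A v \<in> C) \<Longrightarrow> A \<in> compact_ops"
  unfolding compact_ops_iff by auto

lemma compact_opsE:
  assumes "A \<in> compact_ops"
  obtains C where "compact C" "\<And>v. norm v \<le> 1 \<Longrightarrow> blinfun_apply A v \<in> C"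
  using assms unfolding compact_ops_iff by (auto simp: image_subset_iff)

lemma compact_ops_cbounded: "A \<in> compact_ops \<Longrightarrow> A \<in> cbounded"
  by (simp add: compact_ops_def)

lemma compact_ops_zero: "0 \<in> compact_ops"
  by (rule compact_opsI[of _ "{0}"]) (auto simp: cbounded_zero)

lemma compact_ops_add:
  assumes "A \<in> compact_ops" "B \<in> compact_ops"
  shows "A + B \<in> compact_ops"
proof -
  obtain C where C: "compact C" "\<And>v. norm v \<le> 1 \<Longrightarrow> A v \<in> C"
    using compact_opsE[OF assms(1)] by blast
  obtain D where D: "compact D" "\<And>v. norm v \<le> 1 \<Longrightarrow> B v \<in> D"
    using compact_opsE[OF assms(2)] by blast
  show ?thesis
    by (rule compact_opsI[OF _ compact_sums[OF C(1) D(1)]])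
      (use C D assms in \<open>auto simp: blinfun.add_left cbounded_add compact_ops_cbounded\<close>)
qed

lemma compact_ops_compose_left:
  assumes "A \<in> compact_ops" "B \<in> cbounded"
  shows "B o\<^sub>L A \<in> compact_ops"
proof -
  obtain C where C: "compact C" "\<And>v. norm v \<le> 1 \<Longrightarrow> A v \<in> C"
    using compact_opsE[OF assms(1)] by blast
  have "compact (blinfun_apply B ` C)"
    by (intro compact_continuous_image C continuous_intros)
  then show ?thesis
    by (rule compact_opsI[rotated]) (use C assms in \<open>auto simp: cbounded_compose compact_ops_cbounded\<close>)
qed

lemma compact_ops_scaleR:
  assumes "A \<in> compact_ops"
  shows "r *\<^sub>R A \<in> compact_ops"
proof -
  have "(r *\<^sub>R id_blinfun) o\<^sub>L A \<in> compact_ops"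
    by (intro compact_ops_compose_left assms cbounded_scaleR cbounded_id)
  moreover have "(r *\<^sub>R id_blinfun) o\<^sub>L A = r *\<^sub>R A"
    by (rule blinfun_eqI) (simp add: blinfun.scaleR_left)
  ultimately show ?thesis by simp
qed

lemma compact_ops_minus: "A \<in> compact_ops \<Longrightarrow> - A \<in> compact_ops"
  using compact_ops_scaleR[of A "-1"] by simp

lemma compact_ops_diff: "A \<in> compact_ops \<Longrightarrow> B \<in> compact_ops \<Longrightarrow> A - B \<in> compact_ops"
  using compact_ops_add[of A "-B"] by (simp add: compact_ops_minus)

lemma compact_ops_compose_right:
  assumes "A \<in> compact_ops" "B \<in> cbounded"
  shows "A o\<^sub>L B \<in> compact_ops"
proof -
  let ?r = "norm B + 1"
  have r: "?r > 0" using norm_ge_zero[of B] by linarith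
  obtain C where C: "compact C" "\<And>v. norm v \<le> 1 \<Longrightarrow> A v \<in> C"
    using compact_opsE[OF assms(1)] by blast
  have "A ((1 / ?r) *\<^sub>R B v) \<in> C" if "norm v \<le> 1" for v
  proof (rule C)
    have "norm (B v) \<le> norm B * norm v" by (rule norm_blinfun)
    also have "\<dots> \<le> norm B * 1" by (intro mult_left_mono that) simp
    finally show "norm ((1 / ?r) *\<^sub>R B v) \<le> 1" using r by (simp add: divide_le_eq)
  qed
  then have "(1 / ?r) *\<^sub>R (A o\<^sub>L B) \<in> compact_ops"
    by (intro compact_opsI[OF _ C(1)])
      (simp_all add: blinfun.scaleR_left blinfun.scaleR_right cbounded_scaleR cbounded_compose
        compact_ops_cbounded assms)
  then have "?r *\<^sub>R ((1 / ?r) *\<^sub>R (A o\<^sub>L B)) \<in> compact_ops"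
    by (rule compact_ops_scaleR)
  then show ?thesis using r by simp
qed

text \<open>Taking the centres of the net among the images of unit vectors puts the compactness condition into a
  form that survives norm limits and passes to the adjoint.\<close>

lemma compact_ops_iff_totally_bounded:
  fixes A :: "'h::complex_hilbert_space \<Rightarrow>\<^sub>L 'h"
  shows "A \<in> compact_ops \<longleftrightarrow> A \<in> cbounded \<and>
    (\<forall>e>0. \<exists>F. finite F \<and> F \<subseteq> cball 0 1 \<and> (\<forall>v\<in>cball 0 1. \<exists>w\<in>F. norm (A v - A w) < e))"
    (is "_ \<longleftrightarrow> _ \<and> ?T")
proof (intro iffI conjI; (elim conjE)?)
  assume A: "A \<in> compact_ops"
  then show "A \<in> cbounded" by (rule compact_ops_cbounded)
  show ?T
  proof (intro allI impI)
    fix e :: real assume "e > 0"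
    let ?S = "closure (blinfun_apply A ` cball 0 1)"
    have S: "compact ?S"
      using A by (simp add: compact_ops_def)
    have cover: "?S \<subseteq> (\<Union>v\<in>cball 0 1. ball (A v) e)"
    proof
      fix y assume "y \<in> ?S"
      then obtain z where "z \<in> blinfun_apply A ` cball 0 1" "dist z y < e"
        using \<open>e > 0\<close> closure_approachable by blast
      then show "y \<in> (\<Union>v\<in>cball 0 1. ball (A v) e)" by auto
    qed
    obtain F where F: "F \<subseteq> cball 0 1" "finite F" "?S \<subseteq> (\<Union>v\<in>F. ball (A v) e)"
      by (rule compactE_image[OF S _ cover]) auto
    have "\<exists>w\<in>F. norm (A v - A w) < e" if "v \<in> cball 0 1" for v
    proof -
      have "A v \<in> closure (blinfun_apply A ` cball 0 1)"
        by (intro closure_subset[THEN subsetD] imageI that)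
      then show ?thesis using F(3) by (force simp: dist_norm norm_minus_commute)
    qed
    then show "\<exists>F. finite F \<and> F \<subseteq> cball 0 1 \<and> (\<forall>v\<in>cball 0 1. \<exists>w\<in>F. norm (A v - A w) < e)"
      using F by blast
  qed
next
  assume cb: "A \<in> cbounded" and T: ?T
  have "\<exists>k. finite k \<and> closure (blinfun_apply A ` cball 0 1) \<subseteq> (\<Union>x\<in>k. ball x e)"
    if "e > 0" for e
  proof -
    have "e / 2 > 0" using that by simp
    then obtain F where F: "finite F" "\<forall>v\<in>cball 0 1. \<exists>w\<in>F. norm (A v - A w) < e / 2"
      using T by blast
    have "closure (blinfun_apply A ` cball 0 1) \<subseteq> (\<Union>x\<in>blinfun_apply A ` F. ball x e)"
    proof
      fix y assume "y \<in> closure (blinfun_apply A ` cball 0 1)"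
      then obtain v where v: "v \<in> cball 0 1" "dist (A v) y < e / 2"
        using \<open>e / 2 > 0\<close> closure_approachable by blast
      then obtain w where "w \<in> F" "norm (A v - A w) < e / 2" using F by blast
      then have "dist (A w) y < e"
        using v(2) dist_triangle_half_r[of "A v" "A w" e y] by (simp add: dist_norm)
      then show "y \<in> (\<Union>x\<in>blinfun_apply A ` F. ball x e)" using \<open>w \<in> F\<close> by auto
    qed
    then show ?thesis using F(1) by blast
  qed
  then have "compact (closure (blinfun_apply A ` cball 0 1))"
    unfolding compact_eq_totally_bounded by (simp add: complete_eq_closed)
  then show "A \<in> compact_ops" using cb by (simp add: compact_ops_def)
qed

lemma compact_ops_net:
  assumes "A \<in> compact_ops" "e > 0"
  obtains F where "finite F" "F \<subseteq> cball 0 1"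
    "\<And>v. v \<in> cball 0 1 \<Longrightarrow> \<exists>w\<in>F. norm (A v - A w) < e"
  using compact_ops_iff_totally_bounded[THEN iffD1, OF assms(1)] assms(2) by metis

lemma closed_compact_ops: "closed (compact_ops :: ('h::complex_hilbert_space \<Rightarrow>\<^sub>L 'h) set)"
unfolding closed_sequential_limits
proof (intro allI impI, elim conjE)
  fix A :: "nat \<Rightarrow> 'h \<Rightarrow>\<^sub>L 'h" and B
  assume A: "\<forall>n. A n \<in> compact_ops" and lim: "A \<longlonglongrightarrow> B"
  have cb: "B \<in> cbounded"
    using closed_sequentially[OF closed_cbounded _ lim] A compact_ops_cbounded by blast
  have "\<exists>F. finite F \<and> F \<subseteq> cball 0 1 \<and> (\<forall>v\<in>cball 0 1. \<exists>w\<in>F. norm (B v - B w) < e)"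
    if "e > 0" for e
  proof -
    have e3: "e / 3 > 0" using that by simp
    obtain n where n: "norm (A n - B) < e / 3"
      using LIMSEQ_D[OF lim e3] by blast
    have "A n \<in> compact_ops" using A by blast
    from compact_ops_net[OF this e3] obtain F where F: "finite F" "F \<subseteq> cball 0 1"
      "\<And>v. v \<in> cball 0 1 \<Longrightarrow> \<exists>w\<in>F. norm (A n v - A n w) < e / 3" by metis
    have close: "norm ((A n - B) v) < e / 3" if "v \<in> cball 0 1" for v
    proof -
      have "norm ((A n - B) v) \<le> norm (A n - B) * norm v" by (rule norm_blinfun)
      also have "\<dots> \<le> norm (A n - B) * 1" using that by (intro mult_left_mono) auto
      finally show ?thesis using n by simp
    qed
    have "\<exists>w\<in>F. norm (B v - B w) < e" if v: "v \<in> cball 0 1" for v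
    proof -
      obtain w where w: "w \<in> F" "norm (A n v - A n w) < e / 3" using F(3)[OF v] by blast
      have "B v - B w = (A n v - A n w) - (A n - B) v + (A n - B) w"
        by (simp add: blinfun.diff_left)
      also have "norm \<dots> \<le> norm (A n v - A n w) + norm ((A n - B) v) + norm ((A n - B) w)"
        by (intro order_trans[OF norm_triangle_ineq] add_right_mono norm_triangle_ineq4)
      also have "\<dots> < e" using w close[OF v] close[of w] F(2) by auto
      finally show ?thesis using w by blast
    qed
    then show ?thesis using F by blast
  qed
  then show "B \<in> compact_ops" using cb by (simp add: compact_ops_iff_totally_bounded)
qed

text \<open>Schauder's theorem. On the unit ball \<open>\<parallel>A\<^sup>*v - A\<^sup>*w\<parallel>\<^sup>2 \<le> 2 \<parallel>A A\<^sup>*(v - w)\<parallel>\<close>, so a net for the compact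
  operator \<open>A A\<^sup>*\<close> is one for \<open>A\<^sup>*\<close>.\<close>

lemma compact_ops_hilbert_adj:
  assumes "A \<in> compact_ops"
  shows "hilbert_adj A \<in> compact_ops"
proof -
  let ?B = "hilbert_adj A"
  have cb: "?B \<in> cbounded" using assms by (simp add: cbounded_hilbert_adj compact_ops_cbounded)
  then have AB: "A o\<^sub>L ?B \<in> compact_ops" by (rule compact_ops_compose_right[OF assms])
  have "\<exists>F. finite F \<and> F \<subseteq> cball 0 1 \<and> (\<forall>v\<in>cball 0 1. \<exists>w\<in>F. norm (?B v - ?B w) < e)"
    if "e > 0" for e
  proof -
    have "e\<^sup>2 / 2 > 0" using that by simp
    from compact_ops_net[OF AB this] obtain F where F: "finite F" "F \<subseteq> cball 0 1"
      "\<And>v. v \<in> cball 0 1 \<Longrightarrow> \<exists>w\<in>F. norm ((A o\<^sub>L ?B) v - (A o\<^sub>L ?B) w) < e\<^sup>2 / 2"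
      by metis
    have "\<exists>w\<in>F. norm (?B v - ?B w) < e" if v: "v \<in> cball 0 1" for v
    proof -
      obtain w where w: "w \<in> F" "norm ((A o\<^sub>L ?B) v - (A o\<^sub>L ?B) w) < e\<^sup>2 / 2"
        using F(3)[OF v] by blast
      have "(norm (?B v - ?B w))\<^sup>2 = inner (A (?B (v - w))) (v - w)"
        by (simp only: inner_hilbert_adj power2_norm_eq_inner blinfun.diff_right[symmetric])
      also have "\<dots> \<le> norm (A (?B (v - w))) * norm (v - w)" by (rule norm_cauchy_schwarz)
      also have "\<dots> \<le> norm (A (?B (v - w))) * 2"
        using v w(1) F(2) norm_triangle_ineq4[of v w] by (intro mult_left_mono) auto
      also have "\<dots> < e\<^sup>2" using w(2) by (simp add: blinfun.diff_right)
      finally show ?thesis using w(1) \<open>e > 0\<close> by (meson power2_less_imp_less less_imp_le)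
    qed
    then show ?thesis using F by blast
  qed
  then show ?thesis using cb by (simp add: compact_ops_iff_totally_bounded)
qed

lemma compact_ah_iff: "z \<in> compact_ah \<longleftrightarrow> z \<in> compact_ops \<and> hilbert_adj z = - z"
  by (auto simp: compact_ah_def adj_eq_hilbert_adj compact_ops_cbounded)

section \<open>One-parameter groups\<close>

instance complex_hilbert_space \<subseteq> banach ..

interpretation blinfun_compose: bounded_bilinear "(o\<^sub>L)"
  by (rule bounded_bilinear_blinfun_compose)

lemma blinfun_power_scaleR:
  fixes A B :: "'h::complex_hilbert_space \<Rightarrow>\<^sub>L 'h"
  shows "(((o\<^sub>L) (t *\<^sub>R A)) ^^ n) B = t ^ n *\<^sub>R (((o\<^sub>L) A) ^^ n) B"
  by (induction n) (simp_all add: blinfun_compose.scaleR_left blinfun_compose.scaleR_right)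

lemma blinfun_comp_assoc: "(A o\<^sub>L B) o\<^sub>L C = A o\<^sub>L (B o\<^sub>L C)"
  by (rule blinfun_eqI) simp

lemma blinfun_comp_id: "id_blinfun o\<^sub>L A = A" "A o\<^sub>L id_blinfun = A"
  by (rule blinfun_eqI, simp)+

lemma blinfun_power_commute:
  fixes A :: "'h::complex_hilbert_space \<Rightarrow>\<^sub>L 'h"
  shows "(((o\<^sub>L) A) ^^ n) id_blinfun o\<^sub>L A = A o\<^sub>L (((o\<^sub>L) A) ^^ n) id_blinfun"
  by (induction n) (simp_all add: blinfun_comp_assoc blinfun_comp_id)

lemma norm_blinfun_power_le:
  fixes A :: "'h::complex_hilbert_space \<Rightarrow>\<^sub>L 'h"
  shows "norm ((((o\<^sub>L) A) ^^ n) id_blinfun) \<le> norm A ^ n"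
proof (induction n)
  case (Suc n)
  have "norm ((((o\<^sub>L) A) ^^ Suc n) id_blinfun) \<le> norm A * norm ((((o\<^sub>L) A) ^^ n) id_blinfun)"
    by (simp add: norm_blinfun_compose)
  also have "\<dots> \<le> norm A * norm A ^ n"
    by (intro mult_left_mono Suc) simp
  finally show ?case by simp
qed (simp add: norm_blinfun_id_le)

lemma norm_exp_term_le:
  fixes A :: "'h::complex_hilbert_space \<Rightarrow>\<^sub>L 'h"
  assumes "\<bar>t\<bar> \<le> R"
  shows "norm ((t ^ n / fact n) *\<^sub>R (((o\<^sub>L) A) ^^ n) id_blinfun) \<le> inverse (fact n) * (R * norm A) ^ n"
proof -
  have "norm ((t ^ n / fact n) *\<^sub>R (((o\<^sub>L) A) ^^ n) id_blinfun)
      = \<bar>t\<bar> ^ n / fact n * norm ((((o\<^sub>L) A) ^^ n) id_blinfun)"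
    by (simp add: power_abs)
  also have "\<dots> \<le> R ^ n / fact n * norm A ^ n"
    using assms by (intro mult_mono divide_right_mono power_mono norm_blinfun_power_le) auto
  finally show ?thesis by (simp add: power_mult_distrib field_simps)
qed

lemma op_exp_sums:
  fixes A :: "'h::complex_hilbert_space \<Rightarrow>\<^sub>L 'h"
  shows "(\<lambda>n. (t ^ n / fact n) *\<^sub>R (((o\<^sub>L) A) ^^ n) id_blinfun) sums op_exp (t *\<^sub>R A)"
proof -
  have "summable (\<lambda>n. (t ^ n / fact n) *\<^sub>R (((o\<^sub>L) A) ^^ n) id_blinfun)"
    by (rule summable_comparison_test'[OF summable_exp[of "\<bar>t\<bar> * norm A"], of 0])
      (rule norm_exp_term_le, simp)
  moreover have "op_exp (t *\<^sub>R A) = (\<Sum>n. (t ^ n / fact n) *\<^sub>R (((o\<^sub>L) A) ^^ n) id_blinfun)"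
    by (simp add: op_exp_def blinfun_power_scaleR field_simps)
  ultimately show ?thesis by (simp add: summable_sums)
qed

lemma op_exp_zero: "op_exp (0 *\<^sub>R (A :: 'h::complex_hilbert_space \<Rightarrow>\<^sub>L 'h)) = id_blinfun"
proof -
  have "(\<lambda>n. (0 ^ n / fact n) *\<^sub>R (((o\<^sub>L) A) ^^ n) id_blinfun) sums id_blinfun"
  proof -
    have "(\<lambda>n. (0 ^ n / fact n) *\<^sub>R (((o\<^sub>L) A) ^^ n) id_blinfun)
        = (\<lambda>n. if n = 0 then (((o\<^sub>L) A) ^^ n) id_blinfun else 0)"
      by (rule ext) (auto simp: power_0_left)
    then show ?thesis
      using sums_single[of 0 "\<lambda>n. (((o\<^sub>L) A) ^^ n) id_blinfun"] by simp
  qed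
  from sums_unique2[OF op_exp_sums this] show ?thesis .
qed

lemma op_exp_commute:
  fixes A :: "'h::complex_hilbert_space \<Rightarrow>\<^sub>L 'h"
  shows "op_exp (t *\<^sub>R A) o\<^sub>L A = A o\<^sub>L op_exp (t *\<^sub>R A)"
proof -
  have "(\<lambda>n. ((t ^ n / fact n) *\<^sub>R (((o\<^sub>L) A) ^^ n) id_blinfun) o\<^sub>L A) sums (op_exp (t *\<^sub>R A) o\<^sub>L A)"
    by (rule bounded_linear.sums[OF blinfun_compose.bounded_linear_left op_exp_sums])
  moreover have "(\<lambda>n. A o\<^sub>L ((t ^ n / fact n) *\<^sub>R (((o\<^sub>L) A) ^^ n) id_blinfun)) sums (A o\<^sub>L op_exp (t *\<^sub>R A))"
    by (rule bounded_linear.sums[OF blinfun_compose.bounded_linear_right op_exp_sums])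
  ultimately show ?thesis
    by (simp add: blinfun_power_commute blinfun_compose.scaleR_left blinfun_compose.scaleR_right sums_unique2)
qed

text \<open>The exponential series is differentiated term by term: by the bound on its terms it converges uniformly
  on every bounded interval, and so does the series of derivatives.\<close>

lemma op_exp_has_vector_derivative:
  fixes A :: "'h::complex_hilbert_space \<Rightarrow>\<^sub>L 'h"
  shows "((\<lambda>t. op_exp (t *\<^sub>R A)) has_vector_derivative A o\<^sub>L op_exp (t *\<^sub>R A)) (at t)"
proof -
  define P where "P n = (((o\<^sub>L) A) ^^ n) id_blinfun" for n
  have P_Suc: "P (Suc n) = A o\<^sub>L P n" for n by (simp add: P_def)
  define R where "R = \<bar>t\<bar> + 1"
  define S where "S = {-R..R}"
  have S: "convex S" "t \<in> interior S" "\<And>s. s \<in> S \<Longrightarrow> \<bar>s\<bar> \<le> R" "t \<in> S"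
    by (auto simp: S_def R_def)
  have unif: "uniform_limit S (\<lambda>n s. \<Sum>i<n. (s ^ i / fact i) *\<^sub>R P i) (\<lambda>s. \<Sum>i. (s ^ i / fact i) *\<^sub>R P i)
      sequentially"
    using norm_exp_term_le[of _ R _ A] S(3) summable_exp[of "R * norm A"]
    by (intro Weierstrass_m_test[where M="\<lambda>n. inverse (fact n) * (R * norm A) ^ n"]) (auto simp: P_def)
  have sums: "(\<lambda>i. (s ^ i / fact i) *\<^sub>R P i) sums op_exp (s *\<^sub>R A)" for s
    unfolding P_def by (rule op_exp_sums)
  have unif': "uniform_limit S (\<lambda>n s. A o\<^sub>L (\<Sum>i<n. (s ^ i / fact i) *\<^sub>R P i)) (\<lambda>s. A o\<^sub>L op_exp (s *\<^sub>R A))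
      sequentially"
    using bounded_linear.uniform_limit[OF blinfun_compose.bounded_linear_right unif]
    by (simp add: sums_unique[OF sums, symmetric])
  \<comment> \<open>differentiation shifts the index of the partial sums by one, whence the passage from \<open>m\<close> to \<open>Suc m\<close>\<close>
  have "\<exists>g. \<forall>s\<in>S. (\<lambda>n. (s ^ n / fact n) *\<^sub>R P n) sums g s \<and>
      (g has_derivative (\<lambda>h. h *\<^sub>R (A o\<^sub>L op_exp (s *\<^sub>R A)))) (at s within S)"
  proof (rule has_derivative_series[OF S(1) _ _ S(4) sums,
        where f'="\<lambda>n s h. h *\<^sub>R ((real n * s ^ (n - 1) / fact n) *\<^sub>R P n)"])
    show "((\<lambda>s. (s ^ n / fact n) *\<^sub>R P n) has_derivative
        (\<lambda>h. h *\<^sub>R ((real n * s ^ (n - 1) / fact n) *\<^sub>R P n))) (at s within S)" for n s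
      by (auto intro!: derivative_eq_intros)
    fix e :: real assume "e > 0"
    have part: "(\<Sum>i<Suc m. h *\<^sub>R ((real i * s ^ (i - 1) / fact i) *\<^sub>R P i))
        = h *\<^sub>R (A o\<^sub>L (\<Sum>i<m. (s ^ i / fact i) *\<^sub>R P i))" for m s and h :: real
    proof -
      have "(real (Suc i) * s ^ i / fact (Suc i)) = s ^ i / fact i" for i
        by (simp add: divide_simps)
      then show ?thesis
        unfolding sum.lessThan_Suc_shift blinfun_compose.sum_right scaleR_sum_right
        by (simp add: P_Suc blinfun_compose.scaleR_right)
    qed
    have "\<forall>\<^sub>F n in sequentially. \<forall>s\<in>S.
        dist (A o\<^sub>L (\<Sum>i<n. (s ^ i / fact i) *\<^sub>R P i)) (A o\<^sub>L op_exp (s *\<^sub>R A)) < e"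
      using unif' \<open>e > 0\<close> unfolding uniform_limit_iff by blast
    then have "\<forall>\<^sub>F m in sequentially. \<forall>s\<in>S. \<forall>h.
        norm ((\<Sum>i<Suc m. h *\<^sub>R ((real i * s ^ (i - 1) / fact i) *\<^sub>R P i))
          - h *\<^sub>R (A o\<^sub>L op_exp (s *\<^sub>R A))) \<le> e * norm h"
    proof (rule eventually_mono, intro ballI allI)
      fix m s and h :: real
      assume *: "\<forall>s\<in>S. dist (A o\<^sub>L (\<Sum>i<m. (s ^ i / fact i) *\<^sub>R P i)) (A o\<^sub>L op_exp (s *\<^sub>R A)) < e"
        and s: "s \<in> S"
      have "norm (h *\<^sub>R ((A o\<^sub>L (\<Sum>i<m. (s ^ i / fact i) *\<^sub>R P i)) - (A o\<^sub>L op_exp (s *\<^sub>R A)))) \<le> \<bar>h\<bar> * e"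
        unfolding norm_scaleR using *[rule_format, OF s] by (intro mult_left_mono) (auto simp: dist_norm)
      then show "norm ((\<Sum>i<Suc m. h *\<^sub>R ((real i * s ^ (i - 1) / fact i) *\<^sub>R P i))
          - h *\<^sub>R (A o\<^sub>L op_exp (s *\<^sub>R A))) \<le> e * norm h"
        unfolding part by (simp add: scaleR_diff_right mult.commute)
    qed
    then show "\<forall>\<^sub>F n in sequentially. \<forall>s\<in>S. \<forall>h.
        norm ((\<Sum>i<n. h *\<^sub>R ((real i * s ^ (i - 1) / fact i) *\<^sub>R P i))
          - h *\<^sub>R (A o\<^sub>L op_exp (s *\<^sub>R A))) \<le> e * norm h"
      by (rule eventually_sequentially_Suc[THEN iffD1])
  qed
  then obtain g where g: "\<And>s. s \<in> S \<Longrightarrow> (\<lambda>n. (s ^ n / fact n) *\<^sub>R P n) sums g s"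
    "(g has_derivative (\<lambda>h. h *\<^sub>R (A o\<^sub>L op_exp (t *\<^sub>R A)))) (at t within S)"
    using S(4) by blast
  have "g s = op_exp (s *\<^sub>R A)" if "s \<in> S" for s
    using sums_unique2[OF g(1)[OF that] sums] .
  then have "((\<lambda>t. op_exp (t *\<^sub>R A)) has_derivative (\<lambda>h. h *\<^sub>R (A o\<^sub>L op_exp (t *\<^sub>R A)))) (at t within S)"
    using has_derivative_transform[OF S(4) _ g(2)] by metis
  then show ?thesis
    unfolding has_vector_derivative_def using at_within_interior[OF S(2)] by simp
qed

lemma op_exp_has_vector_derivative_within [derivative_intros]:
  fixes A :: "'h::complex_hilbert_space \<Rightarrow>\<^sub>L 'h"
  shows "((\<lambda>t. op_exp (t *\<^sub>R A)) has_vector_derivative A o\<^sub>L op_exp (t *\<^sub>R A)) (at t within S)"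
  using op_exp_has_vector_derivative has_vector_derivative_at_within by blast

lemma op_exp_minus_has_vector_derivative [derivative_intros]:
  fixes A :: "'h::complex_hilbert_space \<Rightarrow>\<^sub>L 'h"
  shows "((\<lambda>t. op_exp (- t *\<^sub>R A)) has_vector_derivative - (A o\<^sub>L op_exp (- t *\<^sub>R A))) (at t within S)"
  using op_exp_has_vector_derivative_within[of "-A" t S]
  by (simp add: blinfun_compose.minus_left)

lemma blinfun_compose_has_vector_derivative [derivative_intros]:
  assumes "(f has_vector_derivative f') (at t within S)"
    and "(g has_vector_derivative g') (at t within S)"
  shows "((\<lambda>s. f s o\<^sub>L g s) has_vector_derivative (f t o\<^sub>L g') + (f' o\<^sub>L g t)) (at t within S)"
  by (rule bounded_bilinear.has_vector_derivative[OF bounded_bilinear_blinfun_compose assms])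

lemma has_vector_derivative_zero_imp_eq:
  fixes f :: "real \<Rightarrow> 'b::real_normed_vector"
  assumes "\<And>t. (f has_vector_derivative 0) (at t)"
  shows "f s = f t"
  using has_vector_derivative_zero_constant[of UNIV f] assms by (metis UNIV_I convex_UNIV)

lemma op_exp_inverse:
  fixes A :: "'h::complex_hilbert_space \<Rightarrow>\<^sub>L 'h"
  shows "op_exp (t *\<^sub>R A) o\<^sub>L op_exp (- t *\<^sub>R A) = id_blinfun"
    and "op_exp (- t *\<^sub>R A) o\<^sub>L op_exp (t *\<^sub>R A) = id_blinfun"
proof -
  have 1: "op_exp (t *\<^sub>R A) o\<^sub>L op_exp (- t *\<^sub>R A) = id_blinfun" for t
  proof -
    have d: "((\<lambda>t. op_exp (t *\<^sub>R A) o\<^sub>L op_exp (- t *\<^sub>R A)) has_vector_derivative 0) (at t)" for t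
      by (rule derivative_eq_intros refl)+
        (simp add: blinfun_compose.minus_right blinfun_comp_assoc[symmetric] op_exp_commute)
    show ?thesis
      using has_vector_derivative_zero_imp_eq[OF d, of t 0] op_exp_zero[of A] by (simp add: blinfun_comp_id)
  qed
  show "op_exp (t *\<^sub>R A) o\<^sub>L op_exp (- t *\<^sub>R A) = id_blinfun" by (rule 1)
  show "op_exp (- t *\<^sub>R A) o\<^sub>L op_exp (t *\<^sub>R A) = id_blinfun" using 1[of "-t"] by simp
qed

lemma op_exp_inverse_apply:
  fixes A :: "'h::complex_hilbert_space \<Rightarrow>\<^sub>L 'h"
  shows "op_exp (t *\<^sub>R A) (op_exp (- t *\<^sub>R A) v) = v"
    and "op_exp (- t *\<^sub>R A) (op_exp (t *\<^sub>R A) v) = v"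
  using op_exp_inverse[of t A] by (metis blinfun_apply_blinfun_compose id_blinfun.rep_eq)+

lemma hilbert_adj_op_exp:
  fixes A :: "'h::complex_hilbert_space \<Rightarrow>\<^sub>L 'h"
  assumes "hilbert_adj A = - A"
  shows "hilbert_adj (op_exp (t *\<^sub>R A)) = op_exp (- t *\<^sub>R A)"
proof -
  have pow: "hilbert_adj ((((o\<^sub>L) A) ^^ n) id_blinfun) = (-1) ^ n *\<^sub>R (((o\<^sub>L) A) ^^ n) id_blinfun" for n
    by (induction n)
      (simp_all add: hilbert_adj_simps assms blinfun_compose.minus_right blinfun_compose.scaleR_left
        blinfun_power_commute)
  have "(\<lambda>n. hilbert_adj ((t ^ n / fact n) *\<^sub>R (((o\<^sub>L) A) ^^ n) id_blinfun)) sums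
      hilbert_adj (op_exp (t *\<^sub>R A))"
    by (rule bounded_linear.sums[OF bounded_linear_hilbert_adj op_exp_sums])
  also have "(\<lambda>n. hilbert_adj ((t ^ n / fact n) *\<^sub>R (((o\<^sub>L) A) ^^ n) id_blinfun)) =
      (\<lambda>n. ((- t) ^ n / fact n) *\<^sub>R (((o\<^sub>L) A) ^^ n) id_blinfun)"
    by (simp add: hilbert_adj_scaleR pow power_minus[of t] mult.commute)
  finally show ?thesis using op_exp_sums sums_unique2 by blast
qed

lemma op_exp_diff_id_compact:
  fixes A :: "'h::complex_hilbert_space \<Rightarrow>\<^sub>L 'h"
  assumes "A \<in> compact_ops"
  shows "op_exp (t *\<^sub>R A) - id_blinfun \<in> compact_ops"
proof -
  let ?f = "\<lambda>n. (t ^ n / fact n) *\<^sub>R (((o\<^sub>L) A) ^^ n) id_blinfun"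
  have cb: "(((o\<^sub>L) A) ^^ n) id_blinfun \<in> cbounded" for n
    by (induction n) (simp_all add: cbounded_id cbounded_compose compact_ops_cbounded assms)
  have "sum ?f {..<Suc n} - id_blinfun \<in> compact_ops" for n
  proof (induction n)
    case (Suc n)
    have "?f (Suc n) \<in> compact_ops"
      by (auto intro!: compact_ops_scaleR compact_ops_compose_right assms cb)
    from compact_ops_add[OF Suc this] show ?case by (simp add: algebra_simps)
  qed (simp add: compact_ops_zero)
  moreover have "(\<lambda>n. sum ?f {..<Suc n} - id_blinfun) \<longlonglongrightarrow> op_exp (t *\<^sub>R A) - id_blinfun"
    using op_exp_sums[of t A] unfolding sums_def
    by (intro tendsto_diff tendsto_const LIMSEQ_Suc)
  ultimately show ?thesis
    by (rule closed_sequentially[OF closed_compact_ops])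
qed

section \<open>The unitary group\<close>

lemma unitary_iff:
  "unitary u \<longleftrightarrow> u \<in> cbounded \<and> hilbert_adj u o\<^sub>L u = id_blinfun \<and> u o\<^sub>L hilbert_adj u = id_blinfun"
  unfolding unitary_def by (auto simp: adj_eq_hilbert_adj)

lemma U_c_iff:
  "u \<in> U_c \<longleftrightarrow> hilbert_adj u o\<^sub>L u = id_blinfun \<and> u o\<^sub>L hilbert_adj u = id_blinfun
    \<and> u - id_blinfun \<in> compact_ops"
proof -
  have "u \<in> cbounded" if "u - id_blinfun \<in> compact_ops"
    using cbounded_add[OF compact_ops_cbounded[OF that] cbounded_id] by simp
  then show ?thesis unfolding U_c_def unitary_iff by auto
qed

lemma U_c_cbounded: "u \<in> U_c \<Longrightarrow> u \<in> cbounded"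
  by (simp add: U_c_def unitary_iff)

lemma U_c_adj: "u \<in> U_c \<Longrightarrow> adj u = hilbert_adj u"
  by (simp add: adj_eq_hilbert_adj U_c_cbounded)

lemma U_c_apply:
  assumes "u \<in> U_c"
  shows "hilbert_adj u (u v) = v" "u (hilbert_adj u v) = v"
  using assms unfolding U_c_iff by (metis blinfun_apply_blinfun_compose id_blinfun.rep_eq)+

lemma U_c_compose:
  assumes "u \<in> U_c" "w \<in> U_c"
  shows "u o\<^sub>L w \<in> U_c"
proof -
  have "(u o\<^sub>L (w - id_blinfun)) + (u - id_blinfun) \<in> compact_ops"
    using assms by (intro compact_ops_add compact_ops_compose_left U_c_cbounded) (auto simp: U_c_iff)
  also have "(u o\<^sub>L (w - id_blinfun)) + (u - id_blinfun) = (u o\<^sub>L w) - id_blinfun"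
    by (rule blinfun_eqI) (simp add: blinfun.add_left blinfun.diff_left blinfun.diff_right)
  finally show ?thesis
    unfolding U_c_iff by (auto intro!: blinfun_eqI simp: hilbert_adj_compose U_c_apply assms)
qed

lemma op_exp_U_c:
  assumes "z \<in> compact_ah"
  shows "op_exp (t *\<^sub>R z) \<in> U_c"
  using assms op_exp_inverse[of t z] unfolding U_c_iff compact_ah_iff
  by (simp add: hilbert_adj_op_exp op_exp_diff_id_compact)

section \<open>Points of the orbit\<close>

text \<open>The relations of the matrix unit \<open>e\<^sub>1\<^sub>2\<close>: with \<open>b\<close> in its place the four operators
  \<open>b b\<^sup>*\<close>, \<open>b\<close>, \<open>b\<^sup>*\<close>, \<open>b\<^sup>* b\<close> form a system of \<open>2 \<times> 2\<close> matrix units. They are all that is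
  used of a point of the orbit, apart from its difference from \<open>N\<close> being compact.\<close>

definition matrix_unit :: "('h::complex_hilbert_space \<Rightarrow>\<^sub>L 'h) \<Rightarrow> bool" where
  "matrix_unit b \<longleftrightarrow> b \<in> cbounded \<and> b o\<^sub>L b = 0 \<and>
    (b o\<^sub>L hilbert_adj b) + (hilbert_adj b o\<^sub>L b) = id_blinfun"

lemma matrix_unit_cbounded: "matrix_unit b \<Longrightarrow> b \<in> cbounded"
  by (simp add: matrix_unit_def)

text \<open>As rewrite rules on vectors these bring every word in \<open>b\<close> and \<open>b\<^sup>*\<close> to a normal form in which no \<open>b\<^sup>* b\<close>
  occurs, which turns the operator identities below into computations.\<close>

lemma matrix_unit_simps:
  assumes "matrix_unit b"
  shows "b (b v) = 0"
    and "hilbert_adj b (hilbert_adj b v) = 0"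
    and "hilbert_adj b (b v) = v - b (hilbert_adj b v)"
proof -
  have b: "b o\<^sub>L b = 0" "(b o\<^sub>L hilbert_adj b) + (hilbert_adj b o\<^sub>L b) = id_blinfun"
    using assms by (simp_all add: matrix_unit_def)
  show "b (b v) = 0"
    using arg_cong[OF b(1), of "\<lambda>A. blinfun_apply A v"] by simp
  have "hilbert_adj b o\<^sub>L hilbert_adj b = hilbert_adj 0"
    by (simp add: hilbert_adj_compose[symmetric] b(1))
  also have "\<dots> = 0" by (rule hilbert_adj_zero)
  finally show "hilbert_adj b (hilbert_adj b v) = 0"
    by (metis blinfun_apply_blinfun_compose blinfun.zero_left)
  show "hilbert_adj b (b v) = v - b (hilbert_adj b v)"
    using arg_cong[OF b(2), of "\<lambda>A. blinfun_apply A v"]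
    by (simp add: blinfun.add_left algebra_simps)
qed

lemma hilbert_adj_block:
  "hilbert_adj (block A B C D) =
    block (hilbert_adj A) (hilbert_adj C) (hilbert_adj B) (hilbert_adj D)"
proof (rule hilbert_adj_eqI)
  fix v w :: "'a \<times> 'a"
  show "inner (block A B C D v) w =
      inner v (block (hilbert_adj A) (hilbert_adj C) (hilbert_adj B) (hilbert_adj D) w)"
    by (cases v; cases w)
      (simp add: inner_Pair inner_add_left inner_add_right inner_hilbert_adj)
qed

lemma block_cbounded:
  assumes "A \<in> cbounded" "B \<in> cbounded" "C \<in> cbounded" "D \<in> cbounded"
  shows "block A B C D \<in> cbounded"
proof (rule cboundedI)
  fix c and v :: "'a \<times> 'a"
  show "block A B C D (c *\<^sub>C v) = c *\<^sub>C block A B C D v"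
    using assms by (cases v) (simp add: scaleC_prod_def cboundedD scaleC_add_right)
qed

lemma block_compact_ops:
  assumes "A \<in> compact_ops" "B \<in> compact_ops" "C \<in> compact_ops" "D \<in> compact_ops"
  shows "block A B C D \<in> compact_ops"
proof -
  obtain KA where A: "compact KA" "\<And>v. norm v \<le> 1 \<Longrightarrow> A v \<in> KA" using compact_opsE[OF assms(1)] by blast
  obtain KB where B: "compact KB" "\<And>v. norm v \<le> 1 \<Longrightarrow> B v \<in> KB" using compact_opsE[OF assms(2)] by blast
  obtain KC where C: "compact KC" "\<And>v. norm v \<le> 1 \<Longrightarrow> C v \<in> KC" using compact_opsE[OF assms(3)] by blast
  obtain KD where D: "compact KD" "\<And>v. norm v \<le> 1 \<Longrightarrow> D v \<in> KD" using compact_opsE[OF assms(4)] by blast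
  let ?K = "{x + y | x y. x \<in> KA \<and> y \<in> KB} \<times> {x + y | x y. x \<in> KC \<and> y \<in> KD}"
  have K: "compact ?K"
    by (intro compact_Times compact_sums A B C D)
  show ?thesis
  proof (rule compact_opsI[OF _ K])
    show "block A B C D \<in> cbounded" using assms by (simp add: block_cbounded compact_ops_cbounded)
    fix v :: "'a \<times> 'a" assume "norm v \<le> 1"
    then have "norm (fst v) \<le> 1" "norm (snd v) \<le> 1"
      using norm_fst_le[of "fst v" "snd v"] norm_snd_le[of "snd v" "fst v"] by auto
    then show "block A B C D v \<in> ?K"
      using A(2) B(2) C(2) D(2) by (cases v) (simp, blast)
  qed
qed

lemma hilbert_adj_N: "hilbert_adj N = block 0 0 id_blinfun 0"
  unfolding N_def hilbert_adj_block by (simp add: hilbert_adj_simps)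

lemma N_apply [simp]: "N (v, w) = (w, 0)"
  by (simp add: N_def)

lemma hilbert_adj_N_apply [simp]: "hilbert_adj N (v, w) = (0, v)"
  by (simp add: hilbert_adj_N)

lemma matrix_unit_N: "matrix_unit N"
  unfolding matrix_unit_def
proof (intro conjI)
  show "N \<in> cbounded" unfolding N_def by (intro block_cbounded cbounded_zero cbounded_id)
  show "N o\<^sub>L N = 0" by (rule blinfun_eqI) (auto simp: zero_prod_def)
  show "(N o\<^sub>L hilbert_adj N) + (hilbert_adj N o\<^sub>L N) = id_blinfun"
    by (rule blinfun_eqI) (auto simp: blinfun.add_left)
qed

lemma matrix_unit_conjugate:
  assumes "matrix_unit b" "u \<in> U_c"
  shows "matrix_unit (u o\<^sub>L b o\<^sub>L hilbert_adj u)"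
  unfolding matrix_unit_def
proof (intro conjI)
  show "u o\<^sub>L b o\<^sub>L hilbert_adj u \<in> cbounded"
    using assms by (intro cbounded_compose cbounded_hilbert_adj) (auto simp: U_c_cbounded matrix_unit_cbounded)
  show "(u o\<^sub>L b o\<^sub>L hilbert_adj u) o\<^sub>L (u o\<^sub>L b o\<^sub>L hilbert_adj u) = 0"
    by (rule blinfun_eqI) (simp add: U_c_apply[OF assms(2)] matrix_unit_simps[OF assms(1)])
  show "((u o\<^sub>L b o\<^sub>L hilbert_adj u) o\<^sub>L hilbert_adj (u o\<^sub>L b o\<^sub>L hilbert_adj u)) +
      (hilbert_adj (u o\<^sub>L b o\<^sub>L hilbert_adj u) o\<^sub>L (u o\<^sub>L b o\<^sub>L hilbert_adj u)) = id_blinfun"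
    by (rule blinfun_eqI)
      (simp add: hilbert_adj_simps U_c_apply[OF assms(2)] matrix_unit_simps[OF assms(1)]
        blinfun.add_left blinfun.diff_right)
qed

lemma orbit_N_iff: "b \<in> orbit_N \<longleftrightarrow> (\<exists>u \<in> U_c. b = u o\<^sub>L N o\<^sub>L hilbert_adj u)"
proof -
  have eq: "u o\<^sub>L N o\<^sub>L hilbert_adj u = u o\<^sub>L N o\<^sub>L adj u" if "u \<in> U_c"
    for u :: "('a \<times> 'a) \<Rightarrow>\<^sub>L ('a \<times> 'a)"
    using that by (simp add: U_c_adj)
  show ?thesis unfolding orbit_N_def by (auto simp: eq)
qed

lemma orbit_N_matrix_unit: "b \<in> orbit_N \<Longrightarrow> matrix_unit b"
  unfolding orbit_N_iff using matrix_unit_conjugate[OF matrix_unit_N] by auto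

lemma orbit_N_diff_compact:
  assumes "b \<in> orbit_N"
  shows "b - N \<in> compact_ops"
proof -
  obtain u where u: "u \<in> U_c" "b = u o\<^sub>L N o\<^sub>L hilbert_adj u" using assms by (auto simp: orbit_N_iff)
  let ?k = "u - id_blinfun"
  have k: "?k \<in> compact_ops" using u(1) by (simp add: U_c_iff)
  have N: "N \<in> cbounded" by (rule matrix_unit_cbounded[OF matrix_unit_N])
  have "(?k o\<^sub>L (N o\<^sub>L hilbert_adj u)) + (N o\<^sub>L hilbert_adj ?k) \<in> compact_ops"
    by (intro compact_ops_add compact_ops_compose_right compact_ops_compose_left k N
        compact_ops_hilbert_adj cbounded_compose cbounded_hilbert_adj U_c_cbounded u(1))
  also have "(?k o\<^sub>L (N o\<^sub>L hilbert_adj u)) + (N o\<^sub>L hilbert_adj ?k) = b - N"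
    by (rule blinfun_eqI)
      (simp add: u(2) hilbert_adj_simps blinfun.add_left blinfun.diff_left blinfun.diff_right)
  finally show ?thesis .
qed

lemma orbit_N_conjugate:
  assumes "b \<in> orbit_N" "u \<in> U_c"
  shows "u o\<^sub>L b o\<^sub>L hilbert_adj u \<in> orbit_N"
proof -
  obtain w where w: "w \<in> U_c" "b = w o\<^sub>L N o\<^sub>L hilbert_adj w" using assms by (auto simp: orbit_N_iff)
  have "u o\<^sub>L b o\<^sub>L hilbert_adj u = (u o\<^sub>L w) o\<^sub>L N o\<^sub>L hilbert_adj (u o\<^sub>L w)"
    by (simp add: w(2) hilbert_adj_compose blinfun_comp_assoc)
  then show ?thesis using U_c_compose[OF assms(2) w(1)] by (auto simp: orbit_N_iff)
qed

section \<open>Tangent vectors and their liftings\<close>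

text \<open>These are the equations that one obtains by differentiating \<open>b b = 0\<close> and \<open>b b\<^sup>* + b\<^sup>* b = 1\<close> along
  a curve.\<close>

definition tangent_equations ::
  "('h::complex_hilbert_space \<Rightarrow>\<^sub>L 'h) \<Rightarrow> ('h \<Rightarrow>\<^sub>L 'h) \<Rightarrow> bool" where
  "tangent_equations b x \<longleftrightarrow> x \<in> compact_ops \<and> (b o\<^sub>L x) + (x o\<^sub>L b) = 0 \<and>
    (b o\<^sub>L hilbert_adj x) + (x o\<^sub>L hilbert_adj b) + ((hilbert_adj b o\<^sub>L x) + (hilbert_adj x o\<^sub>L b)) = 0"

text \<open>At \<open>N\<close> this is the lifting with first row \<open>x\<^sub>1\<close>, \<open>x\<^sub>0\<^sup>*\<close> and second row \<open>- x\<^sub>0\<close>, \<open>0\<close> of the vector with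
  entries \<open>x\<^sub>0\<close>, \<open>x\<^sub>1\<close>. The formula is unitarily invariant and polynomial in \<open>b\<close>, \<open>x\<close> and their adjoints, so
  that it gives liftings at all points of the orbit which depend continuously on both arguments.\<close>

definition tangent_lift ::
  "('h::complex_hilbert_space \<Rightarrow>\<^sub>L 'h) \<Rightarrow> ('h \<Rightarrow>\<^sub>L 'h) \<Rightarrow> ('h \<Rightarrow>\<^sub>L 'h)" where
  "tangent_lift b x = (x o\<^sub>L hilbert_adj b) + (b o\<^sub>L hilbert_adj b o\<^sub>L hilbert_adj x o\<^sub>L b)"

lemma tangent_equations_diff:
  assumes "tangent_equations b x" "tangent_equations b y"
  shows "tangent_equations b (x - y)"
proof -
  have "(b o\<^sub>L (x - y)) + ((x - y) o\<^sub>L b) = ((b o\<^sub>L x) + (x o\<^sub>L b)) - ((b o\<^sub>L y) + (y o\<^sub>L b))"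
    by (simp add: blinfun_compose.diff_left blinfun_compose.diff_right)
  moreover have "(b o\<^sub>L hilbert_adj (x - y)) + ((x - y) o\<^sub>L hilbert_adj b)
      + ((hilbert_adj b o\<^sub>L (x - y)) + (hilbert_adj (x - y) o\<^sub>L b)) =
    ((b o\<^sub>L hilbert_adj x) + (x o\<^sub>L hilbert_adj b) + ((hilbert_adj b o\<^sub>L x) + (hilbert_adj x o\<^sub>L b)))
    - ((b o\<^sub>L hilbert_adj y) + (y o\<^sub>L hilbert_adj b) + ((hilbert_adj b o\<^sub>L y) + (hilbert_adj y o\<^sub>L b)))"
    by (simp add: blinfun_compose.diff_left blinfun_compose.diff_right hilbert_adj_diff)
  ultimately show ?thesis
    using assms by (simp add: tangent_equations_def compact_ops_diff)
qed

lemma hilbert_adj_delta: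
  assumes "hilbert_adj z = - z"
  shows "hilbert_adj (delta b z) = delta (hilbert_adj b) z"
  by (rule blinfun_eqI)
    (simp add: delta_def hilbert_adj_simps assms blinfun.diff_left blinfun.minus_left blinfun.minus_right)

lemma delta_compact:
  assumes "z \<in> compact_ops" "b \<in> cbounded"
  shows "delta b z \<in> compact_ops"
  unfolding delta_def
  by (intro compact_ops_diff compact_ops_compose_left compact_ops_compose_right assms)

lemma tangent_equations_delta:
  assumes b: "matrix_unit b" and z: "z \<in> compact_ah"
  shows "tangent_equations b (delta b z)"
proof -
  have z': "z \<in> compact_ops" "hilbert_adj z = - z" using z by (auto simp: compact_ah_iff)
  show ?thesis
    unfolding tangent_equations_def hilbert_adj_delta[OF z'(2)]
    using delta_compact[OF z'(1) matrix_unit_cbounded[OF b]]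
    by (auto intro!: blinfun_eqI
        simp: delta_def matrix_unit_simps[OF b] blinfun.add_left blinfun.diff_left blinfun.diff_right)
qed

lemma tangent_lift_is_lifting:
  assumes b: "matrix_unit b" and x: "tangent_equations b x"
  shows "delta b (tangent_lift b x) = x" and "tangent_lift b x \<in> compact_ah"
proof -
  have xb: "x (b v) = - b (x v)" for v
  proof -
    have "(b o\<^sub>L x) + (x o\<^sub>L b) = 0" using x by (simp add: tangent_equations_def)
    from arg_cong[OF this, of "\<lambda>A. blinfun_apply A v"] show ?thesis
      by (simp add: blinfun.add_left eq_neg_iff_add_eq_0 add.commute)
  qed
  have S: "b (hilbert_adj x v) + x (hilbert_adj b v) + (hilbert_adj b (x v) + hilbert_adj x (b v)) = 0" for v
  proof -
    have "(b o\<^sub>L hilbert_adj x) + (x o\<^sub>L hilbert_adj b) + ((hilbert_adj b o\<^sub>L x) + (hilbert_adj x o\<^sub>L b)) = 0"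
      using x by (simp add: tangent_equations_def)
    from arg_cong[OF this, of "\<lambda>A. blinfun_apply A v"] show ?thesis
      by (simp add: blinfun.add_left)
  qed
  show "delta b (tangent_lift b x) = x"
    by (rule blinfun_eqI)
      (simp add: delta_def tangent_lift_def matrix_unit_simps[OF b] xb blinfun.add_left
        blinfun.diff_left blinfun.diff_right blinfun.add_right blinfun.minus_right)
  have "hilbert_adj (tangent_lift b x) v + tangent_lift b x v = 0" for v
  proof -
    \<comment> \<open>the symmetric part of the lifting is \<open>b b\<^sup>*\<close> times the second tangent equation\<close>
    have "hilbert_adj (tangent_lift b x) v + tangent_lift b x v =
      b (hilbert_adj b (b (hilbert_adj x v) + x (hilbert_adj b v) + (hilbert_adj b (x v) + hilbert_adj x (b v))))"
      by (simp add: tangent_lift_def hilbert_adj_simps matrix_unit_simps[OF b] xb blinfun.add_left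
        blinfun.diff_left blinfun.diff_right blinfun.add_right blinfun.minus_right)
    then show ?thesis by (simp add: S)
  qed
  then have "hilbert_adj (tangent_lift b x) = - tangent_lift b x"
    by (intro blinfun_eqI) (simp add: blinfun.minus_left eq_neg_iff_add_eq_0)
  moreover have "tangent_lift b x \<in> compact_ops"
    using b x unfolding tangent_lift_def
    by (intro compact_ops_add compact_ops_compose_left compact_ops_compose_right
        compact_ops_hilbert_adj cbounded_hilbert_adj cbounded_compose matrix_unit_cbounded)
      (auto simp: tangent_equations_def)
  ultimately show "tangent_lift b x \<in> compact_ah" by (simp add: compact_ah_iff)
qed

lemma finsler_norm_le:
  assumes "z \<in> compact_ah" "delta b z = x"
  shows "finsler_norm b x \<le> norm z"
  unfolding finsler_norm_def using assms by (intro cInf_lower) (auto intro!: bdd_belowI[of _ 0])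

lemma finsler_norm_ge:
  assumes "matrix_unit b" "tangent_equations b x"
    and "\<And>z. z \<in> compact_ah \<Longrightarrow> delta b z = x \<Longrightarrow> c \<le> norm z"
  shows "c \<le> finsler_norm b x"
  unfolding finsler_norm_def using assms tangent_lift_is_lifting by (intro cInf_greatest) blast+

lemma finsler_norm_less_iff:
  assumes "matrix_unit b" "tangent_equations b x"
  shows "finsler_norm b x < c \<longleftrightarrow> (\<exists>z\<in>compact_ah. delta b z = x \<and> norm z < c)"
proof
  assume "finsler_norm b x < c"
  then show "\<exists>z\<in>compact_ah. delta b z = x \<and> norm z < c"
    using finsler_norm_ge[OF assms, of c] by (meson not_le)
qed (use finsler_norm_le le_less_trans in blast)

text \<open>As \<open>b b\<close> and \<open>b\<^sup>* b\<^sup>*\<close> vanish, the square of \<open>b - b\<^sup>*\<close> is \<open>- (b b\<^sup>* + b\<^sup>* b)\<close>.\<close>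

lemma matrix_unit_skew_apply:
  assumes "matrix_unit b"
  shows "(b - hilbert_adj b) ((b - hilbert_adj b) v) = - v"
  by (simp add: matrix_unit_simps[OF assms] blinfun.diff_left blinfun.diff_right)

lemma norm_matrix_unit_skew:
  assumes "matrix_unit b"
  shows "norm ((b - hilbert_adj b) v) = norm v"
proof -
  let ?J = "b - hilbert_adj b"
  have "inner (?J v) (?J v) = inner v (hilbert_adj ?J (?J v))"
    by (rule inner_hilbert_adj)
  also have "hilbert_adj ?J = - ?J" by (simp add: hilbert_adj_simps)
  also have "inner v ((- ?J) (?J v)) = inner v v"
    by (simp only: blinfun.minus_left matrix_unit_skew_apply[OF assms] minus_minus)
  finally show ?thesis by (simp add: norm_eq_sqrt_inner)
qed

text \<open>Two liftings differ by some \<open>w\<close> that commutes with \<open>b\<close>, and with \<open>b\<^sup>*\<close> because it is skew-adjoint; hence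
  it commutes with \<open>J = b - b\<^sup>*\<close>. Conjugation by the isometry \<open>J\<close> thus takes \<open>z\<^sub>0 + w\<close> to \<open>- z\<^sub>0 + w\<close>, and \<open>z\<^sub>0\<close> is half
  the difference of two operators of norm \<open>\<parallel>z\<^sub>0 + w\<parallel>\<close>.\<close>

lemma anticommuting_lifting_minimal:
  assumes b: "matrix_unit b" and z0: "z0 \<in> compact_ah"
    and anti: "\<And>v. z0 ((b - hilbert_adj b) v) = - (b - hilbert_adj b) (z0 v)"
  shows "minimal_lifting b (delta b z0) z0"
proof -
  let ?J = "b - hilbert_adj b"
  have "norm z0 \<le> norm z" if z: "z \<in> compact_ah" "delta b z = delta b z0" for z
  proof -
    define w where "w = z - z0"
    have w_adj: "hilbert_adj w = - w"
      using z z0 by (simp add: w_def compact_ah_iff hilbert_adj_simps)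
    have "delta b w = 0"
      using z(2) by (simp add: w_def delta_def blinfun_compose.diff_left blinfun_compose.diff_right algebra_simps)
    then have "delta (hilbert_adj b) w = 0"
      using hilbert_adj_delta[OF w_adj, of b] by (simp add: hilbert_adj_zero)
    have com: "w (c v) = c (w v)" if "delta c w = 0" for c v
      using arg_cong[OF that, of "\<lambda>A. blinfun_apply A v"]
      by (simp add: delta_def blinfun.diff_left)
    note com[OF \<open>delta b w = 0\<close>] com[OF \<open>delta (hilbert_adj b) w = 0\<close>]
    then have w_J: "w (?J v) = ?J (w v)" for v
      by (simp add: blinfun.diff_left blinfun.diff_right)
    have eq: "z v + ?J (z (?J v)) = 2 *\<^sub>R z0 v" for v
    proof -
      have "z u = z0 u + w u" for u by (simp add: w_def blinfun.diff_left)
      then have "z v + ?J (z (?J v)) = z0 v + w v + ?J (?J (w v) - ?J (z0 v))"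
        by (simp only: anti w_J) (simp add: blinfun.add_right)
      also have "\<dots> = 2 *\<^sub>R z0 v"
        by (simp only: blinfun.diff_right matrix_unit_skew_apply[OF b]) (simp add: scaleR_2)
      finally show ?thesis .
    qed
    show ?thesis
    proof (rule norm_blinfun_bound)
      fix v
      have "2 * norm (z0 v) = norm (z v + ?J (z (?J v)))"
        unfolding eq by simp
      also have "\<dots> \<le> norm (z v) + norm (z (?J v))"
        using norm_triangle_ineq[of "z v" "?J (z (?J v))"] by (simp add: norm_matrix_unit_skew[OF b])
      also have "\<dots> \<le> norm z * norm v + norm z * norm v"
        using norm_blinfun[of z v] norm_blinfun[of z "?J v"]
        unfolding norm_matrix_unit_skew[OF b] by (rule add_mono)
      finally show "norm (z0 v) \<le> norm z * norm v" by (simp add: mult.commute)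
    qed simp
  qed
  then have "norm z0 = finsler_norm b (delta b z0)"
    by (intro antisym finsler_norm_ge finsler_norm_le tangent_equations_delta b z0) auto
  then show ?thesis using z0 by (simp add: minimal_lifting_def)
qed

text \<open>At \<open>N\<close> the liftings of a vector with entries \<open>x\<^sub>0\<close>, \<open>x\<^sub>1\<close> have off-diagonal entries \<open>x\<^sub>0\<^sup>*\<close> and \<open>- x\<^sub>0\<close>, and
  diagonal entries with difference \<open>x\<^sub>1\<close>. Antisymmetry makes the off-diagonal entries equal; splitting \<open>x\<^sub>1\<close>
  evenly makes the diagonal ones opposite, and a matrix of this shape anticommutes with \<open>N - N\<^sup>*\<close>.\<close>

lemma antisymmetric_anticommuting_lifting:
  assumes "antisymmetric_at b x"
  obtains z where "z \<in> compact_ah" "delta b z = x"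
    "\<And>v. z ((b - hilbert_adj b) v) = - (b - hilbert_adj b) (z v)"
proof -
  obtain u x0 x1 where u: "u \<in> U_c" "b = u o\<^sub>L N o\<^sub>L adj u"
    and x0: "x0 \<in> compact_ops" "adj x0 = - x0" and x1: "x1 \<in> compact_ops" "adj x1 = - x1"
    and eq: "adj u o\<^sub>L x o\<^sub>L u = block x0 x1 0 (- x0)"
    using assms unfolding antisymmetric_at_def antisymmetric_at_N_def by blast
  have adj: "hilbert_adj x0 = - x0" "hilbert_adj x1 = - x1"
    using x0 x1 adj_eq_hilbert_adj compact_ops_cbounded by metis+
  have b: "b = u o\<^sub>L N o\<^sub>L hilbert_adj u" using u by (simp add: U_c_adj)
  define y where "y = block ((1/2) *\<^sub>R x1) (- x0) (- x0) (- (1/2) *\<^sub>R x1)"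
  have y_adj: "hilbert_adj y = - y"
  proof -
    have "hilbert_adj y = block (- (1/2) *\<^sub>R x1) x0 x0 ((1/2) *\<^sub>R x1)"
      unfolding y_def hilbert_adj_block by (simp add: hilbert_adj_simps adj)
    also have "\<dots> = - y"
      by (rule blinfun_eqI) (auto simp: y_def blinfun.minus_left blinfun.scaleR_left)
    finally show ?thesis .
  qed
  have y_N: "delta N y = block x0 x1 0 (- x0)"
    by (rule blinfun_eqI)
      (auto simp: delta_def y_def blinfun.minus_left blinfun.diff_left blinfun.scaleR_left
        blinfun.zero_right scaleR_add_left[symmetric])
  have y_anti: "y (N v - hilbert_adj N v) = hilbert_adj N (y v) - N (y v)" for v
    by (cases v)
      (simp add: y_def blinfun.minus_left blinfun.minus_right blinfun.scaleR_left blinfun.scaleR_right)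
  define z where "z = u o\<^sub>L y o\<^sub>L hilbert_adj u"
  note U = U_c_apply[OF u(1)]
  have "y \<in> compact_ops"
    unfolding y_def by (intro block_compact_ops compact_ops_minus compact_ops_scaleR x0 x1)
  then have "z \<in> compact_ops"
    unfolding z_def
    by (intro compact_ops_compose_left compact_ops_compose_right cbounded_hilbert_adj U_c_cbounded u(1))
  moreover have "hilbert_adj z = - z"
    by (rule blinfun_eqI)
      (simp add: z_def hilbert_adj_simps y_adj blinfun.minus_left blinfun.minus_right)
  ultimately have "z \<in> compact_ah" by (simp add: compact_ah_iff)
  moreover have "delta b z = x"
  proof (rule blinfun_eqI)
    fix v
    have "delta b z v = u (delta N y (hilbert_adj u v))"
      by (simp add: delta_def b z_def U blinfun.diff_left blinfun.diff_right)
    also have "delta N y = hilbert_adj u o\<^sub>L x o\<^sub>L u"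
      using eq y_N u(1) by (simp add: U_c_adj)
    finally show "delta b z v = x v" by (simp add: U)
  qed
  moreover have "z ((b - hilbert_adj b) v) = - (b - hilbert_adj b) (z v)" for v
  proof -
    have "z ((b - hilbert_adj b) v) = u (y (N (hilbert_adj u v) - hilbert_adj N (hilbert_adj u v)))"
      by (simp add: z_def b hilbert_adj_simps U blinfun.diff_left blinfun.diff_right)
    also have "\<dots> = - (b - hilbert_adj b) (z v)"
      unfolding y_anti by (simp add: z_def b hilbert_adj_simps U blinfun.diff_left blinfun.diff_right)
    finally show ?thesis .
  qed
  ultimately show ?thesis using that by blast
qed

section \<open>Curves in the orbit\<close>

lemma has_vector_derivative_const_imp_zero:
  fixes f :: "real \<Rightarrow> 'b::real_normed_vector"
  assumes "p < q" "t \<in> {p..q}" "(f has_vector_derivative d) (at t within {p..q})"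
    and "\<And>s. s \<in> {p..q} \<Longrightarrow> f s = k"
  shows "d = 0"
proof -
  have "(f has_vector_derivative 0) (at t within {p..q})"
    by (rule has_vector_derivative_transform[of _ _ _ "\<lambda>_. k"]) (use assms in auto)
  then show ?thesis
    using vector_derivative_unique_within_closed_interval[of p q t f d 0] assms by simp
qed

lemma has_vector_derivative_in_closed_subspace:
  fixes f :: "real \<Rightarrow> 'b::real_normed_vector"
  assumes "p < q" "t \<in> {p..q}" "(f has_vector_derivative d) (at t within {p..q})"
    and "closed V" "\<And>s. s \<in> {p..q} \<Longrightarrow> f s - f t \<in> V"
    and scale: "\<And>r x. x \<in> V \<Longrightarrow> r *\<^sub>R x \<in> V"
  shows "d \<in> V"
proof -
  have "((\<lambda>s. (1 / (s - t)) *\<^sub>R (f s - f t)) \<longlongrightarrow> d) (at t within {p..q})"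
  proof -
    have "((\<lambda>s. (f s - (f t + (s - t) *\<^sub>R d)) /\<^sub>R norm (s - t)) \<longlongrightarrow> 0) (at t within {p..q})"
      using assms(3) unfolding has_vector_derivative_def has_derivative_within by (simp add: inverse_eq_divide)
    then have "((\<lambda>s. norm ((f s - (f t + (s - t) *\<^sub>R d)) /\<^sub>R norm (s - t))) \<longlongrightarrow> 0) (at t within {p..q})"
      by (rule tendsto_norm_zero)
    moreover have "\<forall>\<^sub>F s in at t within {p..q}. norm ((f s - (f t + (s - t) *\<^sub>R d)) /\<^sub>R norm (s - t)) =
        norm ((1 / (s - t)) *\<^sub>R (f s - f t) - d)"
    proof (unfold eventually_at_filter, rule always_eventually, intro allI impI)
      fix s assume "s \<noteq> t"
      then have "(1 / (s - t)) *\<^sub>R (f s - f t) - d = (1 / (s - t)) *\<^sub>R (f s - (f t + (s - t) *\<^sub>R d))"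
        by (simp add: scaleR_diff_right scaleR_add_right)
      then show "norm ((f s - (f t + (s - t) *\<^sub>R d)) /\<^sub>R norm (s - t)) =
          norm ((1 / (s - t)) *\<^sub>R (f s - f t) - d)"
        by (simp add: divide_inverse)
    qed
    ultimately have "((\<lambda>s. norm ((1 / (s - t)) *\<^sub>R (f s - f t) - d)) \<longlongrightarrow> 0) (at t within {p..q})"
      using tendsto_cong by fast
    then show ?thesis
      by (rule LIM_zero_cancel[OF tendsto_norm_zero_cancel])
  qed
  moreover have "\<forall>\<^sub>F s in at t within {p..q}. (1 / (s - t)) *\<^sub>R (f s - f t) \<in> V"
    using assms(5) scale by (auto simp: eventually_at_filter)
  moreover have "at t within {p..q} \<noteq> bot"
    using assms(1,2) by (simp add: trivial_limit_within)
  ultimately show ?thesis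
    by (intro Lim_in_closed_set[OF assms(4), of "\<lambda>s. (1 / (s - t)) *\<^sub>R (f s - f t)"])
qed

lemma hilbert_adj_has_vector_derivative [derivative_intros]:
  assumes "(f has_vector_derivative f') (at t within S)"
  shows "((\<lambda>s. hilbert_adj (f s)) has_vector_derivative hilbert_adj f') (at t within S)"
  by (rule bounded_linear.has_vector_derivative[OF bounded_linear_hilbert_adj assms])

text \<open>The Finsler norm of a vector without liftings is an infimum over the empty set; this lemma ensures that
  the velocities of curves in the orbit do have liftings.\<close>

lemma orbit_curve_tangent:
  assumes pq: "p < q" "t \<in> {p..q}" and d: "(\<beta> has_vector_derivative w) (at t within {p..q})"
    and orb: "\<And>s. s \<in> {p..q} \<Longrightarrow> \<beta> s \<in> orbit_N"
  shows "tangent_equations (\<beta> t) w"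
proof -
  have "w \<in> compact_ops"
  proof (rule has_vector_derivative_in_closed_subspace[OF pq d closed_compact_ops])
    show "\<beta> s - \<beta> t \<in> compact_ops" if "s \<in> {p..q}" for s
      using compact_ops_diff[OF orbit_N_diff_compact[OF orb[OF that]] orbit_N_diff_compact[OF orb[OF pq(2)]]]
      by simp
  qed (rule compact_ops_scaleR)
  moreover have "(\<beta> t o\<^sub>L w) + (w o\<^sub>L \<beta> t) = 0"
    by (rule has_vector_derivative_const_imp_zero[OF pq blinfun_compose_has_vector_derivative[OF d d], of 0])
      (use orb orbit_N_matrix_unit in \<open>auto simp: matrix_unit_def\<close>)
  moreover have "(\<beta> t o\<^sub>L hilbert_adj w) + (w o\<^sub>L hilbert_adj (\<beta> t))
      + ((hilbert_adj (\<beta> t) o\<^sub>L w) + (hilbert_adj w o\<^sub>L \<beta> t)) = 0"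
  proof (rule has_vector_derivative_const_imp_zero[OF pq, of _ _ id_blinfun])
    note d' = hilbert_adj_has_vector_derivative[OF d]
    show "((\<lambda>s. (\<beta> s o\<^sub>L hilbert_adj (\<beta> s)) + (hilbert_adj (\<beta> s) o\<^sub>L \<beta> s)) has_vector_derivative
        (\<beta> t o\<^sub>L hilbert_adj w) + (w o\<^sub>L hilbert_adj (\<beta> t))
      + ((hilbert_adj (\<beta> t) o\<^sub>L w) + (hilbert_adj w o\<^sub>L \<beta> t))) (at t within {p..q})"
      by (intro has_vector_derivative_add blinfun_compose_has_vector_derivative d d')
  qed (use orb orbit_N_matrix_unit in \<open>auto simp: matrix_unit_def\<close>)
  ultimately show ?thesis by (simp add: tangent_equations_def)
qed

lemma finsler_norm_nonneg:
  assumes "matrix_unit b" "tangent_equations b x"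
  shows "0 \<le> finsler_norm b x"
  by (rule finsler_norm_ge[OF assms]) simp

text \<open>For a fixed skew-adjoint \<open>z\<close> the operators \<open>z + tangent_lift (\<beta> t) (w t - delta (\<beta> t) z)\<close> are liftings of \<open>w t\<close>
  that depend continuously on \<open>t\<close>, and every lifting at \<open>t\<close> is of this form, for \<open>z\<close> the lifting itself.
  So the Finsler speed is an infimum of continuous functions: it is upper semicontinuous, hence measurable,
  and it is bounded.\<close>

lemma finsler_norm_curve_integrable:
  assumes cont: "continuous_on {p..q} \<beta>" "continuous_on {p..q} w"
    and unit: "\<And>t. t \<in> {p..q} \<Longrightarrow> matrix_unit (\<beta> t)"
    and tang: "\<And>t. t \<in> {p..q} \<Longrightarrow> tangent_equations (\<beta> t) (w t)"
  shows "(\<lambda>t::real. finsler_norm (\<beta> t) (w t)) integrable_on {p..q}"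
proof (rule measurable_bounded_by_integrable_imp_integrable)
  define G where "G z t = norm (z + tangent_lift (\<beta> t) (w t - delta (\<beta> t) z))" for z t
  note [continuous_intros] = bounded_bilinear.continuous_on[OF bounded_bilinear_blinfun_compose]
    bounded_linear.continuous_on[OF bounded_linear_hilbert_adj]
  have G: "continuous_on {p..q} (G z)" for z
    unfolding G_def tangent_lift_def delta_def by (intro continuous_intros cont)
  have less_iff: "finsler_norm (\<beta> t) (w t) < a \<longleftrightarrow> (\<exists>z\<in>compact_ah. G z t < a)" if t: "t \<in> {p..q}" for t a
  proof
    assume "finsler_norm (\<beta> t) (w t) < a"
    then obtain z where "z \<in> compact_ah" "delta (\<beta> t) z = w t" "norm z < a"
      using finsler_norm_less_iff[OF unit[OF t] tang[OF t]] by blast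
    then show "\<exists>z\<in>compact_ah. G z t < a"
      by (intro bexI[of _ z]) (simp_all add: G_def tangent_lift_def hilbert_adj_zero)
  next
    assume "\<exists>z\<in>compact_ah. G z t < a"
    then obtain z where z: "z \<in> compact_ah" "G z t < a" by blast
    define y where "y = tangent_lift (\<beta> t) (w t - delta (\<beta> t) z)"
    have "tangent_equations (\<beta> t) (w t - delta (\<beta> t) z)"
      by (intro tangent_equations_diff tang t tangent_equations_delta unit z)
    from tangent_lift_is_lifting[OF unit[OF t] this]
    have y: "delta (\<beta> t) y = w t - delta (\<beta> t) z" "y \<in> compact_ah"
      by (simp_all add: y_def)
    have "z + y \<in> compact_ah"
      using z(1) y(2) by (simp add: compact_ah_iff compact_ops_add hilbert_adj_simps)
    moreover have "delta (\<beta> t) (z + y) = w t"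
      using y(1) by (simp add: delta_def blinfun_compose.add_left blinfun_compose.add_right algebra_simps)
    ultimately have "finsler_norm (\<beta> t) (w t) \<le> norm (z + y)" by (rule finsler_norm_le)
    then show "finsler_norm (\<beta> t) (w t) < a" using z(2) by (simp add: G_def y_def)
  qed
  show "(\<lambda>t. finsler_norm (\<beta> t) (w t)) \<in> borel_measurable (lebesgue_on {p..q})"
    unfolding borel_measurable_iff_less
  proof
    fix a
    have "{t \<in> space (lebesgue_on {p..q}). finsler_norm (\<beta> t) (w t) < a} =
        \<Union> ((\<lambda>z. {p..q} \<inter> G z -` {..<a}) ` compact_ah)"
      using less_iff by auto
    moreover have "openin (top_of_set {p..q}) (\<Union> ((\<lambda>z. {p..q} \<inter> G z -` {..<a}) ` compact_ah))"
      by (intro openin_Union) (auto intro!: continuous_openin_preimage_gen G)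
    ultimately obtain T where "open T"
      "{t \<in> space (lebesgue_on {p..q}). finsler_norm (\<beta> t) (w t) < a} = {p..q} \<inter> T"
      by (auto simp: openin_open)
    then show "{t \<in> space (lebesgue_on {p..q}). finsler_norm (\<beta> t) (w t) < a} \<in> sets (lebesgue_on {p..q})"
      by (simp add: sets_restrict_space image_iff) (metis Int_commute borel_open sets_completionI_sets sets_lborel)
  qed
  show "G 0 integrable_on {p..q}"
    by (rule integrable_continuous_real[OF G])
  show "norm (finsler_norm (\<beta> t) (w t)) \<le> G 0 t" if t: "t \<in> {p..q}" for t
  proof -
    have "finsler_norm (\<beta> t) (w t) \<le> norm (tangent_lift (\<beta> t) (w t))"
      by (intro finsler_norm_le tangent_lift_is_lifting unit tang t)
    then show ?thesis
      using finsler_norm_nonneg[OF unit[OF t] tang[OF t]] by (simp add: G_def delta_def)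
  qed
  show "{p..q} \<in> sets lebesgue" by simp
qed

lemma inner_skew_zero:
  assumes "hilbert_adj z = - z"
  shows "inner v (z v) = 0"
  using inner_hilbert_adj'[of v z v] by (simp add: assms blinfun.minus_left inner_commute)

text \<open>If \<open>z\<close> lifts \<open>x\<close>, the velocity \<open>x - x\<^sup>*\<close> of \<open>J = b - b\<^sup>*\<close> is the commutator of \<open>z\<close> and \<open>J\<close>; so it has norm
  at most \<open>2 \<parallel>z\<parallel>\<close>, whichever lifting is taken. The second claim says that \<open>J v\<close> stays on the unit sphere.\<close>

lemma skew_part_speed:
  assumes b: "matrix_unit b" and x: "tangent_equations b x" and v: "norm v = 1"
  shows "norm ((x - hilbert_adj x) v) \<le> 2 * finsler_norm b x"
    and "inner ((b - hilbert_adj b) v) ((x - hilbert_adj x) v) = 0"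
proof -
  let ?J = "b - hilbert_adj b"
  have eq: "(x - hilbert_adj x) v = z (?J v) - ?J (z v)"
    if "z \<in> compact_ah" "delta b z = x" for z
  proof -
    have "hilbert_adj x = delta (hilbert_adj b) z"
      using that hilbert_adj_delta[of z b] by (auto simp: compact_ah_iff)
    then have "(x - hilbert_adj x) v = delta b z v - delta (hilbert_adj b) z v"
      using that by (simp add: blinfun.diff_left)
    then show ?thesis by (simp add: delta_def blinfun.diff_left blinfun.diff_right)
  qed
  have "norm ((x - hilbert_adj x) v) / 2 \<le> finsler_norm b x"
  proof (rule finsler_norm_ge[OF b x])
    fix z assume z: "z \<in> compact_ah" "delta b z = x"
    have "norm (z (?J v) - ?J (z v)) \<le> norm (z (?J v)) + norm (z v)"
      using norm_triangle_ineq4[of "z (?J v)" "?J (z v)"] by (simp add: norm_matrix_unit_skew[OF b])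
    also have "\<dots> \<le> norm z + norm z"
      using norm_blinfun[of z v] norm_blinfun[of z "?J v"]
      unfolding norm_matrix_unit_skew[OF b] v by simp
    finally show "norm ((x - hilbert_adj x) v) / 2 \<le> norm z" by (simp add: eq[OF z])
  qed
  then show "norm ((x - hilbert_adj x) v) \<le> 2 * finsler_norm b x" by simp
  define z where "z = tangent_lift b x"
  have z: "z \<in> compact_ah" "delta b z = x" using tangent_lift_is_lifting[OF b x] by (simp_all add: z_def)
  then have z': "hilbert_adj z = - z" by (simp add: compact_ah_iff)
  have "inner (?J v) (?J (z v)) = inner (hilbert_adj ?J (?J v)) (z v)"
    by (rule inner_hilbert_adj')
  also have "hilbert_adj ?J = - ?J" by (simp add: hilbert_adj_simps)
  also have "inner ((- ?J) (?J v)) (z v) = inner v (z v)"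
    by (simp only: blinfun.minus_left matrix_unit_skew_apply[OF b] minus_minus)
  finally show "inner (?J v) ((x - hilbert_adj x) v) = 0"
    unfolding eq[OF z] inner_diff_right by (simp add: inner_skew_zero[OF z'])
qed

text \<open>Only the component of \<open>\<xi>\<close> orthogonal to \<open>v\<close> contributes to the inner product with \<open>v'\<close>.\<close>

lemma sphere_speed_bound:
  fixes \<xi> v v' :: "'h::real_inner"
  assumes "norm \<xi> = 1" "norm v = 1" "inner v v' = 0"
  shows "\<bar>inner \<xi> v'\<bar> \<le> sqrt (1 - (inner \<xi> v)\<^sup>2) * norm v'"
proof -
  let ?u = "\<xi> - inner \<xi> v *\<^sub>R v"
  have "(norm ?u)\<^sup>2 = (norm \<xi>)\<^sup>2 - 2 * (inner \<xi> v)\<^sup>2 + (inner \<xi> v)\<^sup>2 * (norm v)\<^sup>2"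
    unfolding power2_norm_eq_inner
    by (simp add: inner_diff_left inner_diff_right inner_commute power2_eq_square algebra_simps)
  then have "norm ?u = sqrt (1 - (inner \<xi> v)\<^sup>2)"
    using assms by (simp add: real_sqrt_unique)
  moreover have "inner \<xi> v' = inner ?u v'"
    using assms by (simp add: inner_diff_left)
  ultimately show ?thesis
    using Cauchy_Schwarz_ineq2[of ?u v'] by simp
qed

text \<open>On the unit sphere the angle to a fixed vector changes at most as fast as the point moves. The
  inverse cosine is not differentiable at \<open>\<plusminus>1\<close>, values that \<open>f\<close> does take; scaling by \<open>\<rho> < 1\<close> keeps its
  argument inside the open interval, and the speed bound survives because
  \<open>\<rho>\<^sup>2 (1 - f\<^sup>2) \<le> 1 - (\<rho> f)\<^sup>2\<close>.\<close>

lemma arccos_variation_le_length: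
  assumes pq: "p < q" and cont: "continuous_on {p..q} w"
    and d: "\<And>t. t \<in> {p..q} \<Longrightarrow> (\<beta> has_vector_derivative w t) (at t within {p..q})"
    and orb: "\<And>t. t \<in> {p..q} \<Longrightarrow> \<beta> t \<in> orbit_N"
    and norm: "norm \<xi> = 1" "norm \<eta> = 1" and \<rho>: "0 < \<rho>" "\<rho> < 1"
    and f: "\<And>t. f t = inner \<xi> ((\<beta> t - hilbert_adj (\<beta> t)) \<eta>)"
  shows "(\<lambda>t. finsler_norm (\<beta> t) (w t)) integrable_on {p..q}"
    and "\<bar>arccos (\<rho> * f q) - arccos (\<rho> * f p)\<bar> \<le> 2 * integral {p..q} (\<lambda>t. finsler_norm (\<beta> t) (w t))"
proof -
  let ?F = "\<lambda>t. finsler_norm (\<beta> t) (w t)"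
  have unit: "matrix_unit (\<beta> t)" if "t \<in> {p..q}" for t
    using orbit_N_matrix_unit[OF orb[OF that]] .
  have tang: "tangent_equations (\<beta> t) (w t)" if "t \<in> {p..q}" for t
    using orbit_curve_tangent[OF pq that d[OF that] orb] .
  have "continuous_on {p..q} \<beta>"
    using d by (rule continuous_on_vector_derivative)
  then show F: "?F integrable_on {p..q}"
    using cont unit tang by (rule finsler_norm_curve_integrable)
  define f' where "f' t = inner \<xi> ((w t - hilbert_adj (w t)) \<eta>)" for t
  have f_d: "(f has_vector_derivative f' t) (at t within {p..q})" if "t \<in> {p..q}" for t
  proof -
    have "bounded_linear (\<lambda>A. inner \<xi> ((A - hilbert_adj A) \<eta>))"
      by (intro bounded_linear_compose[OF bounded_linear_inner_right]
          bounded_linear_compose[OF blinfun.bounded_linear_left] bounded_linear_sub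
          bounded_linear_ident bounded_linear_hilbert_adj)
    from bounded_linear.has_vector_derivative[OF this d[OF that]]
    show ?thesis unfolding f f'_def .
  qed
  have f_bound: "\<bar>f t\<bar> \<le> 1" if "t \<in> {p..q}" for t
    using Cauchy_Schwarz_ineq2[of \<xi> "(\<beta> t - hilbert_adj (\<beta> t)) \<eta>"]
    by (simp add: f norm norm_matrix_unit_skew[OF unit[OF that]])
  define g' where "g' t = - (\<rho> * f' t) / sqrt (1 - (\<rho> * f t)\<^sup>2)" for t
  have \<rho>f: "\<bar>\<rho> * f t\<bar> < 1" if "t \<in> {p..q}" for t
  proof -
    have "\<bar>\<rho> * f t\<bar> \<le> \<rho> * 1"
      unfolding abs_mult using f_bound[OF that] \<rho> by (intro mult_mono) auto
    then show ?thesis using \<rho> by simp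
  qed
  have g_d: "((\<lambda>t. arccos (\<rho> * f t)) has_vector_derivative g' t) (at t within {p..q})"
    if t: "t \<in> {p..q}" for t
  proof -
    have "(f has_real_derivative f' t) (at t within {p..q})"
      using f_d[OF t] by (simp add: has_real_derivative_iff_has_vector_derivative)
    then have "((\<lambda>t. \<rho> * f t) has_real_derivative \<rho> * f' t) (at t within {p..q})"
      by (rule DERIV_cmult)
    moreover have "(arccos has_real_derivative inverse (- sqrt (1 - (\<rho> * f t)\<^sup>2))) (at (\<rho> * f t))"
      using \<rho>f[OF t] by (intro DERIV_arccos) auto
    ultimately have "((\<lambda>t. arccos (\<rho> * f t)) has_real_derivative
        inverse (- sqrt (1 - (\<rho> * f t)\<^sup>2)) * (\<rho> * f' t)) (at t within {p..q})"
      by (rule DERIV_chain2[rotated])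
    then show ?thesis
      unfolding g'_def has_real_derivative_iff_has_vector_derivative[symmetric]
      by (simp add: divide_inverse mult_ac)
  qed
  have g_int: "(g' has_integral arccos (\<rho> * f q) - arccos (\<rho> * f p)) {p..q}"
    using pq g_d by (intro fundamental_theorem_of_calculus) auto
  have g_bound: "norm (g' t) \<le> 2 * ?F t" if t: "t \<in> {p..q}" for t
  proof -
    let ?v = "(\<beta> t - hilbert_adj (\<beta> t)) \<eta>" and ?v' = "(w t - hilbert_adj (w t)) \<eta>"
    have F0: "0 \<le> ?F t" using finsler_norm_nonneg[OF unit[OF t] tang[OF t]] .
    have sq: "(\<rho> * f t)\<^sup>2 < 1"
      using \<rho>f[OF t] by (simp add: abs_square_less_1)
    have "\<bar>f' t\<bar> \<le> sqrt (1 - (f t)\<^sup>2) * norm ?v'"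
      unfolding f f'_def
      using norm_matrix_unit_skew[OF unit[OF t]] skew_part_speed(2)[OF unit[OF t] tang[OF t] norm(2)]
      by (intro sphere_speed_bound) (simp_all add: norm)
    also have "\<dots> \<le> sqrt (1 - (f t)\<^sup>2) * (2 * ?F t)"
      using skew_part_speed(1)[OF unit[OF t] tang[OF t] norm(2)] f_bound[OF t]
      by (intro mult_left_mono) (simp_all add: abs_square_le_1)
    finally have "\<rho> * \<bar>f' t\<bar> \<le> \<rho> * (sqrt (1 - (f t)\<^sup>2) * (2 * ?F t))"
      using \<rho> by (intro mult_left_mono) auto
    also have "\<dots> = sqrt (\<rho>\<^sup>2 * (1 - (f t)\<^sup>2)) * (2 * ?F t)"
      using \<rho> by (simp add: real_sqrt_mult)
    also have "\<dots> \<le> sqrt (1 - (\<rho> * f t)\<^sup>2) * (2 * ?F t)"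
    proof (intro mult_right_mono real_sqrt_le_mono)
      have "\<rho>\<^sup>2 \<le> 1" using \<rho> by (simp add: power_le_one)
      then show "\<rho>\<^sup>2 * (1 - (f t)\<^sup>2) \<le> 1 - (\<rho> * f t)\<^sup>2"
        by (simp add: power_mult_distrib algebra_simps)
    qed (use F0 in simp)
    finally have "\<rho> * \<bar>f' t\<bar> / sqrt (1 - (\<rho> * f t)\<^sup>2) \<le> 2 * ?F t"
      using sq by (simp add: divide_le_eq mult.commute)
    then show ?thesis
      using \<rho> sq by (simp add: g'_def abs_mult)
  qed
  have "norm (integral {p..q} g') \<le> integral {p..q} (\<lambda>t. 2 * ?F t)"
    using g_int F g_bound
    by (intro integral_norm_bound_integral integrable_on_cmult_left) (auto simp: has_integral_integrable)
  then show "\<bar>arccos (\<rho> * f q) - arccos (\<rho> * f p)\<bar> \<le> 2 * integral {p..q} ?F"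
    using integral_unique[OF g_int] by simp
qed

text \<open>The estimates for the smooth pieces add up. Inside a piece the derivative within the piece and within the
  whole parameter interval agree, and the finitely many corners do not affect the integral.\<close>

lemma piecewise_arccos_variation_le_length:
  assumes pw: "piecewise_smooth_curve_on c d \<beta>"
    and orb: "\<And>t. t \<in> {c..d} \<Longrightarrow> \<beta> t \<in> orbit_N"
    and norm: "norm \<xi> = 1" "norm \<eta> = 1" and \<rho>: "0 < \<rho>" "\<rho> < 1"
    and f: "\<And>t. f t = inner \<xi> ((\<beta> t - hilbert_adj (\<beta> t)) \<eta>)"
  shows "\<bar>arccos (\<rho> * f d) - arccos (\<rho> * f c)\<bar> \<le> 2 * curve_length c d \<beta>"
proof -
  let ?L = "\<lambda>t. finsler_norm (\<beta> t) (vector_derivative \<beta> (at t within {c..d}))"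
  obtain n p where p: "p 0 = c" "p n = d" "\<And>i. i < n \<Longrightarrow> smooth_curve_on (p i) (p (Suc i)) \<beta>"
    using pw unfolding piecewise_smooth_curve_on_def by blast
  have less: "p i < p (Suc i)" if "i < n" for i
    using p(3)[OF that] by (simp add: smooth_curve_on_def)
  have mono: "p i \<le> p j" if "i \<le> j" "j \<le> n" for i j
    using that
  proof (induction j rule: dec_induct)
    case (step k)
    then show ?case using less[of k] by simp
  qed simp
  have "?L integrable_on {p 0..p k} \<and>
      \<bar>arccos (\<rho> * f (p k)) - arccos (\<rho> * f (p 0))\<bar> \<le> 2 * integral {p 0..p k} ?L" if "k \<le> n" for k
    using that
  proof (induction k)
    case (Suc k)
    then have k: "k < n" by simp
    have IH: "?L integrable_on {p 0..p k}"
      "\<bar>arccos (\<rho> * f (p k)) - arccos (\<rho> * f (p 0))\<bar> \<le> 2 * integral {p 0..p k} ?L"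
      using Suc by auto
    let ?I = "{p k..p (Suc k)}"
    have sub: "?I \<subseteq> {c..d}"
      using mono[of 0 k] mono[of "Suc k" n] k p(1,2) by auto
    obtain w where w: "continuous_on ?I w"
      "\<And>t. t \<in> ?I \<Longrightarrow> (\<beta> has_vector_derivative w t) (at t within ?I)"
      using p(3)[OF k] unfolding smooth_curve_on_def by blast
    note seg = arccos_variation_le_length[OF less[OF k] w orb[OF subsetD[OF sub]] norm \<rho> f]
    have same: "?L t = finsler_norm (\<beta> t) (w t)" if "t \<in> ?I - {p k, p (Suc k)}" for t
    proof -
      have t: "t \<in> interior ?I" "t \<in> interior {c..d}"
        using that mono[of 0 k] mono[of "Suc k" n] k p(1,2) by auto
      have "(\<beta> has_vector_derivative w t) (at t)"
        using w(2)[of t] that at_within_interior[OF t(1)] by simp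
      then show ?thesis
        unfolding at_within_interior[OF t(2)] by (simp add: vector_derivative_at)
    qed
    have seg_int: "?L integrable_on ?I"
      by (rule integrable_spike_finite[where S="{p k, p (Suc k)}", OF _ same seg(1)]) simp
    have seg_eq: "integral ?I ?L = integral ?I (\<lambda>t. finsler_norm (\<beta> t) (w t))"
      by (rule integral_spike[where S="{p k, p (Suc k)}"], rule negligible_finite) (simp_all add: same)
    have ord: "p 0 \<le> p k" "p k \<le> p (Suc k)" using mono[of 0 k] less[OF k] k by auto
    have int: "?L integrable_on {p 0..p (Suc k)}"
      by (rule Henstock_Kurzweil_Integration.integrable_combine[OF ord IH(1) seg_int])
    have "integral {p 0..p k} ?L + integral ?I ?L = integral {p 0..p (Suc k)} ?L"
      by (rule Henstock_Kurzweil_Integration.integral_combine[OF ord int])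
    then show ?case
      using int IH(2) seg(2) seg_eq by linarith
  qed (use integrable_on_refl[of ?L "p 0"] in simp)
  from this[of n] show ?thesis by (simp add: p curve_length_def)
qed

lemma arccos_scaled_tendsto:
  assumes "\<bar>x\<bar> \<le> 1"
  shows "(\<lambda>n. arccos ((1 - inverse (real (Suc (Suc n)))) * x)) \<longlonglongrightarrow> arccos x"
proof (rule continuous_on_tendsto_compose[OF continuous_on_arccos'])
  have "(\<lambda>n. (1 - inverse (real (Suc (Suc n)))) * x) \<longlonglongrightarrow> (1 - 0) * x"
    by (intro tendsto_intros LIMSEQ_Suc[OF LIMSEQ_inverse_real_of_nat])
  then show "(\<lambda>n. (1 - inverse (real (Suc (Suc n)))) * x) \<longlonglongrightarrow> x" by simp
  show "x \<in> {-1..1}" using assms by auto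
  show "\<forall>\<^sub>F n in sequentially. (1 - inverse (real (Suc (Suc n)))) * x \<in> {-1..1}"
  proof (rule always_eventually, rule allI)
    fix n
    have "inverse (real (Suc (Suc n))) \<le> 1" by (simp add: inverse_le_1_iff)
    then have "\<bar>(1 - inverse (real (Suc (Suc n)))) * x\<bar> \<le> 1 * 1"
      unfolding abs_mult using assms by (intro mult_mono) auto
    then show "(1 - inverse (real (Suc (Suc n)))) * x \<in> {-1..1}" by (simp add: abs_le_iff)
  qed
qed

text \<open>This is the limit of the scaled estimates as the factor tends to one.\<close>

lemma angle_le_length:
  assumes pw: "piecewise_smooth_curve_on c d \<beta>"
    and orb: "\<And>t. t \<in> {c..d} \<Longrightarrow> \<beta> t \<in> orbit_N"
    and norm: "norm \<xi> = 1" "norm \<eta> = 1"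
    and f: "\<And>t. f t = inner \<xi> ((\<beta> t - hilbert_adj (\<beta> t)) \<eta>)"
    and bound: "\<bar>f c\<bar> \<le> 1" "\<bar>f d\<bar> \<le> 1"
  shows "\<bar>arccos (f d) - arccos (f c)\<bar> \<le> 2 * curve_length c d \<beta>"
proof (rule LIMSEQ_le_const2)
  let ?r = "\<lambda>n. 1 - inverse (real (Suc (Suc n)))"
  show "(\<lambda>n. \<bar>arccos (?r n * f d) - arccos (?r n * f c)\<bar>) \<longlonglongrightarrow> \<bar>arccos (f d) - arccos (f c)\<bar>"
    by (intro tendsto_rabs tendsto_diff arccos_scaled_tendsto bound)
  have "\<bar>arccos (?r n * f d) - arccos (?r n * f c)\<bar> \<le> 2 * curve_length c d \<beta>" for n
    by (rule piecewise_arccos_variation_le_length[OF pw orb norm _ _ f])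
      (simp_all add: inverse_less_1_iff)
  then show "\<exists>M. \<forall>n\<ge>M. \<bar>arccos (?r n * f d) - arccos (?r n * f c)\<bar> \<le> 2 * curve_length c d \<beta>"
    by blast
qed

section \<open>Norm-attaining vectors of the generator\<close>

text \<open>By compactness the norm of \<open>z\<close> is attained in the closure of the image of the unit ball, as the norm of
  a limit \<open>y\<close> of vectors \<open>z v\<^sub>n\<close>. Since \<open>z\<^sup>2 \<le> 0\<close> has norm \<open>\<parallel>z\<parallel>\<^sup>2\<close>, the \<open>v\<^sub>n\<close> are approximate eigenvectors of
  \<open>z\<^sup>2\<close>, and \<open>y\<close> is a true one.\<close>

lemma compact_skew_maximal_vector:
  fixes z :: "'h::complex_hilbert_space \<Rightarrow>\<^sub>L 'h"
  assumes z: "z \<in> compact_ah" and nz: "z \<noteq> 0"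
  obtains y where "norm y = 1" "z (z y) = - (norm z)\<^sup>2 *\<^sub>R y"
proof -
  have skew: "hilbert_adj z = - z" using z by (simp add: compact_ah_iff)
  let ?S = "closure (blinfun_apply z ` cball 0 1)"
  have "compact ?S" using z by (simp add: compact_ah_def compact_ops_def)
  moreover have "?S \<noteq> {}" by (simp add: closure_eq_empty)
  ultimately obtain y where y: "y \<in> ?S" "\<And>x. x \<in> ?S \<Longrightarrow> norm x \<le> norm y"
    using continuous_attains_sup[of ?S norm] continuous_on_norm_id by blast
  let ?m = "norm z"
  have m: "?m > 0" using nz by simp
  have in_S: "z v \<in> ?S" if "norm v \<le> 1" for v
    using that by (intro closure_subset[THEN subsetD] imageI) auto
  have "?m \<le> norm y"
  proof (rule norm_blinfun_bound)
    fix v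
    show "norm (z v) \<le> norm y * norm v"
    proof (cases "v = 0")
      case False
      have "norm (z ((1 / norm v) *\<^sub>R v)) \<le> norm y"
        using False by (intro y(2) in_S) simp
      then show ?thesis using False by (simp add: blinfun.scaleR_right divide_le_eq)
    qed simp
  qed simp
  from y(1) obtain u where u: "\<And>n. u n \<in> blinfun_apply z ` cball 0 1" "u \<longlonglongrightarrow> y"
    unfolding closure_sequential by blast
  then have "\<forall>n. \<exists>v. norm v \<le> 1 \<and> u n = z v" by fastforce
  then obtain v where v: "\<And>n. norm (v n) \<le> 1" "\<And>n. u n = z (v n)" by metis
  have lim: "(\<lambda>n. z (v n)) \<longlonglongrightarrow> y" using u(2) unfolding v(2)[abs_def] .
  have zv_le: "norm (z (v n)) \<le> ?m" for n
    using norm_blinfun[of z "v n"] mult_left_mono[OF v(1)[of n], of ?m] by simp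
  have "norm y \<le> ?m"
    using LIMSEQ_le_const2[OF tendsto_norm[OF lim]] zv_le by blast
  with \<open>?m \<le> norm y\<close> have norm_y: "norm y = ?m" by simp
  \<comment> \<open>the defect of the approximate eigenvectors\<close>
  define e where "e n = z (z (v n)) + ?m\<^sup>2 *\<^sub>R v n" for n
  have e_le: "(norm (e n))\<^sup>2 \<le> ?m ^ 4 - ?m\<^sup>2 * (norm (z (v n)))\<^sup>2" for n
  proof -
    have expand: "(norm (a + r *\<^sub>R c))\<^sup>2 = (norm a)\<^sup>2 + 2 * (r * inner a c) + r\<^sup>2 * (norm c)\<^sup>2"
      for a c :: 'h and r
      unfolding power2_norm_eq_inner
      by (simp add: inner_add_left inner_add_right inner_commute power2_eq_square algebra_simps)
    have 1: "inner (z (z (v n))) (v n) = - (norm (z (v n)))\<^sup>2"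
      unfolding inner_hilbert_adj skew power2_norm_eq_inner
      by (simp add: blinfun.minus_left blinfun.minus_right)
    have "(norm (e n))\<^sup>2 = (norm (z (z (v n))))\<^sup>2 + 2 * (?m\<^sup>2 * inner (z (z (v n))) (v n))
        + ?m ^ 4 * (norm (v n))\<^sup>2"
      unfolding e_def expand by (simp flip: power_mult)
    also have "\<dots> \<le> ?m\<^sup>2 * (norm (z (v n)))\<^sup>2 + 2 * (?m\<^sup>2 * inner (z (z (v n))) (v n)) + ?m ^ 4 * 1"
    proof (intro add_mono mult_left_mono order_refl)
      have "(norm (z (z (v n))))\<^sup>2 \<le> (?m * norm (z (v n)))\<^sup>2"
        by (intro power_mono norm_blinfun) simp
      then show "(norm (z (z (v n))))\<^sup>2 \<le> ?m\<^sup>2 * (norm (z (v n)))\<^sup>2" by (simp add: power_mult_distrib)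
      show "(norm (v n))\<^sup>2 \<le> 1" using v(1)[of n] by (simp add: power_le_one)
    qed simp_all
    finally show ?thesis unfolding 1 by simp
  qed
  have "(\<lambda>n. ?m ^ 4 - ?m\<^sup>2 * (norm (z (v n)))\<^sup>2) \<longlonglongrightarrow> ?m ^ 4 - ?m\<^sup>2 * (norm y)\<^sup>2"
    by (intro tendsto_intros lim)
  also have "?m ^ 4 - ?m\<^sup>2 * (norm y)\<^sup>2 = 0"
    unfolding norm_y by (simp add: power4_eq_xxxx power2_eq_square)
  finally have "(\<lambda>n. (norm (e n))\<^sup>2) \<longlonglongrightarrow> 0"
    by (rule tendsto_sandwich[OF _ _ tendsto_const, rotated 2]) (use e_le in \<open>auto intro: always_eventually\<close>)
  then have "(\<lambda>n. sqrt ((norm (e n))\<^sup>2)) \<longlonglongrightarrow> sqrt 0"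
    by (rule tendsto_real_sqrt)
  then have "e \<longlonglongrightarrow> 0" by (simp add: tendsto_norm_zero_iff)
  then have "(\<lambda>n. z (e n)) \<longlonglongrightarrow> z 0" by (intro tendsto_intros)
  moreover have "(\<lambda>n. z (e n)) \<longlonglongrightarrow> z (z y) + ?m\<^sup>2 *\<^sub>R y"
    unfolding e_def blinfun.add_right blinfun.scaleR_right by (intro tendsto_intros lim)
  ultimately have "z (z y) + ?m\<^sup>2 *\<^sub>R y = 0"
    using LIMSEQ_unique by fastforce
  then have zzy: "z (z y) = - ?m\<^sup>2 *\<^sub>R y" by (simp add: eq_neg_iff_add_eq_0)
  show ?thesis
  proof (rule that)
    show "norm ((1 / ?m) *\<^sub>R y) = 1" using m by (simp add: norm_y)
    show "z (z ((1 / ?m) *\<^sub>R y)) = - ?m\<^sup>2 *\<^sub>R ((1 / ?m) *\<^sub>R y)"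
      by (simp add: blinfun.scaleR_right zzy)
  qed
qed

lemma op_exp_commute_apply:
  fixes z :: "'h::complex_hilbert_space \<Rightarrow>\<^sub>L 'h"
  shows "op_exp (t *\<^sub>R z) (z v) = z (op_exp (t *\<^sub>R z) v)"
  using arg_cong[OF op_exp_commute[of t z], of "\<lambda>A. blinfun_apply A v"] by simp

text \<open>On the plane spanned by \<open>y\<close> and \<open>z y\<close> the one-parameter group is a rotation with angular velocity \<open>m\<close>: the
  right-hand side solves \<open>h' = z h\<close>, so \<open>exp (- t z) h\<close> is constant.\<close>

lemma op_exp_maximal_vector:
  fixes z :: "'h::complex_hilbert_space \<Rightarrow>\<^sub>L 'h"
  assumes m: "m > 0" and y: "z (z y) = - m\<^sup>2 *\<^sub>R y"
  shows "op_exp (t *\<^sub>R z) y = cos (m * t) *\<^sub>R y + (sin (m * t) / m) *\<^sub>R z y"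
proof -
  define h where "h t = cos (m * t) *\<^sub>R y + (sin (m * t) / m) *\<^sub>R z y" for t
  have h: "(h has_vector_derivative z (h t)) (at t)" for t
  proof -
    have "(h has_vector_derivative (- sin (m * t) * m) *\<^sub>R y + (cos (m * t)) *\<^sub>R z y) (at t)"
      unfolding h_def using m by (auto intro!: derivative_eq_intros simp: has_vector_derivative_def
          scaleR_diff_right mult_ac)
    also have "(- sin (m * t) * m) *\<^sub>R y + (cos (m * t)) *\<^sub>R z y = z (h t)"
      using m by (simp add: h_def blinfun.add_right blinfun.scaleR_right y power2_eq_square)
    finally show ?thesis .
  qed
  have "((\<lambda>t. op_exp (- t *\<^sub>R z) (h t)) has_vector_derivative 0) (at t)" for t
  proof -
    have "((\<lambda>t. op_exp (- t *\<^sub>R z) (h t)) has_vector_derivative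
        op_exp (- t *\<^sub>R z) (z (h t)) + (- (z o\<^sub>L op_exp (- t *\<^sub>R z))) (h t)) (at t)"
      by (intro bounded_bilinear.has_vector_derivative[OF bounded_bilinear_blinfun_apply]
          op_exp_minus_has_vector_derivative h)
    then show ?thesis
      by (simp only: op_exp_commute_apply blinfun.minus_left blinfun_apply_blinfun_compose
          add.right_inverse)
  qed
  from has_vector_derivative_zero_imp_eq[OF this, of t 0]
  have "op_exp (- t *\<^sub>R z) (h t) = y"
    using op_exp_zero[of z] by (simp add: h_def)
  then have "op_exp (t *\<^sub>R z) y = op_exp (t *\<^sub>R z) (op_exp (- t *\<^sub>R z) (h t))" by simp
  also have "\<dots> = h t" by (rule op_exp_inverse_apply)
  finally show ?thesis by (simp add: h_def)
qed

lemma inner_op_exp_maximal_vector: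
  fixes z :: "'h::complex_hilbert_space \<Rightarrow>\<^sub>L 'h"
  assumes skew: "hilbert_adj z = - z" and m: "m > 0"
    and y: "z (z y) = - m\<^sup>2 *\<^sub>R y" "norm y = 1"
  shows "inner y (op_exp (t *\<^sub>R z) (op_exp (t *\<^sub>R z) y)) = cos (2 * (m * t))"
proof -
  have yy: "inner y y = 1" using y(2) by (simp add: norm_eq_sqrt_inner)
  have orth: "inner y (z y) = 0" "inner (z y) y = 0"
    using inner_skew_zero[OF skew, of y] by (simp_all add: inner_commute)
  have zz: "inner (z y) (z y) = m\<^sup>2"
    unfolding inner_hilbert_adj skew by (simp add: blinfun.minus_left y(1) yy)
  have "inner y (op_exp (t *\<^sub>R z) (op_exp (t *\<^sub>R z) y))
      = inner (op_exp (- t *\<^sub>R z) y) (op_exp (t *\<^sub>R z) y)"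
    unfolding inner_hilbert_adj' hilbert_adj_op_exp[OF skew] by simp
  also have "\<dots> = (cos (m * t))\<^sup>2 - (sin (m * t) / m)\<^sup>2 * m\<^sup>2"
    unfolding op_exp_maximal_vector[OF m y(1)]
    by (simp add: inner_add_left inner_add_right inner_diff_left orth yy zz power2_eq_square)
  also have "\<dots> = cos (2 * (m * t))"
    using m by (simp add: cos_double power_divide)
  finally show ?thesis .
qed

text \<open>The product \<open>exp (- t z) J exp (- t z)\<close> has derivative zero, so it is \<open>J\<close> for all \<open>t\<close>. Hence conjugating
  \<open>J\<close> by \<open>exp (t z)\<close> amounts to multiplying it by \<open>exp (2 t z)\<close>.\<close>

lemma op_exp_anticommute:
  fixes J z :: "'h::complex_hilbert_space \<Rightarrow>\<^sub>L 'h"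
  assumes anti: "\<And>v. z (J v) = - J (z v)"
  shows "J (op_exp (- t *\<^sub>R z) v) = op_exp (t *\<^sub>R z) (J v)"
proof -
  have anti': "J (z v) = - z (J v)" for v using anti[of v] by simp
  let ?W = "\<lambda>t. op_exp (- t *\<^sub>R z) o\<^sub>L (J o\<^sub>L op_exp (- t *\<^sub>R z))"
  have "(?W has_vector_derivative 0) (at t)" for t
  proof -
    have "(?W has_vector_derivative
        (op_exp (- t *\<^sub>R z) o\<^sub>L ((J o\<^sub>L (- (z o\<^sub>L op_exp (- t *\<^sub>R z)))) + (0 o\<^sub>L op_exp (- t *\<^sub>R z)))) +
        ((- (z o\<^sub>L op_exp (- t *\<^sub>R z))) o\<^sub>L (J o\<^sub>L op_exp (- t *\<^sub>R z)))) (at t)"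
      by (intro blinfun_compose_has_vector_derivative op_exp_minus_has_vector_derivative
          has_vector_derivative_const)
    moreover have "(op_exp (- t *\<^sub>R z) o\<^sub>L ((J o\<^sub>L (- (z o\<^sub>L op_exp (- t *\<^sub>R z)))) + (0 o\<^sub>L op_exp (- t *\<^sub>R z)))) +
        ((- (z o\<^sub>L op_exp (- t *\<^sub>R z))) o\<^sub>L (J o\<^sub>L op_exp (- t *\<^sub>R z))) = 0"
      by (rule blinfun_eqI)
        (simp only: blinfun.add_left blinfun.add_right blinfun.minus_left blinfun.minus_right
          blinfun_apply_blinfun_compose anti' op_exp_commute_apply blinfun.zero_left minus_minus
          blinfun.zero_right add_0_right right_minus)
    ultimately show ?thesis by simp
  qed
  from has_vector_derivative_zero_imp_eq[OF this, of t 0]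
  have W: "?W t = J" using op_exp_zero[of z] by (simp add: blinfun_comp_id)
  have "op_exp (- t *\<^sub>R z) (J (op_exp (- t *\<^sub>R z) v)) = J v"
    using arg_cong[OF W, of "\<lambda>A. blinfun_apply A v"] by simp
  then have "op_exp (t *\<^sub>R z) (J v) = op_exp (t *\<^sub>R z) (op_exp (- t *\<^sub>R z) (J (op_exp (- t *\<^sub>R z) v)))"
    by simp
  also have "\<dots> = J (op_exp (- t *\<^sub>R z) v)" by (rule op_exp_inverse_apply)
  finally show ?thesis by simp
qed

section \<open>Minimality\<close>

definition orbit_curve ::
  "('h::complex_hilbert_space \<Rightarrow>\<^sub>L 'h) \<Rightarrow> ('h \<Rightarrow>\<^sub>L 'h) \<Rightarrow> real \<Rightarrow> ('h \<Rightarrow>\<^sub>L 'h)" where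
  "orbit_curve b z t = op_exp (t *\<^sub>R z) o\<^sub>L b o\<^sub>L op_exp (- t *\<^sub>R z)"

lemma orbit_curve_zero: "orbit_curve b z 0 = b"
  using op_exp_zero[of z] by (simp add: orbit_curve_def blinfun_comp_id)

lemma orbit_curve_in_orbit:
  assumes "b \<in> orbit_N" "z \<in> compact_ah"
  shows "orbit_curve b z t \<in> orbit_N"
  using orbit_N_conjugate[OF assms(1) op_exp_U_c[OF assms(2), of t]] assms(2)
  by (simp add: orbit_curve_def hilbert_adj_op_exp compact_ah_iff)

lemma orbit_curve_has_vector_derivative:
  "(orbit_curve b z has_vector_derivative delta (orbit_curve b z t) z) (at t within S)"
proof -
  have "(orbit_curve b z has_vector_derivative
      ((op_exp (t *\<^sub>R z) o\<^sub>L b) o\<^sub>L (- (z o\<^sub>L op_exp (- t *\<^sub>R z)))) +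
      (((op_exp (t *\<^sub>R z) o\<^sub>L 0) + ((z o\<^sub>L op_exp (t *\<^sub>R z)) o\<^sub>L b)) o\<^sub>L op_exp (- t *\<^sub>R z))) (at t within S)"
    unfolding orbit_curve_def
    by (intro blinfun_compose_has_vector_derivative op_exp_minus_has_vector_derivative
        op_exp_has_vector_derivative_within has_vector_derivative_const)
  moreover have "((op_exp (t *\<^sub>R z) o\<^sub>L b) o\<^sub>L (- (z o\<^sub>L op_exp (- t *\<^sub>R z)))) +
      (((op_exp (t *\<^sub>R z) o\<^sub>L 0) + ((z o\<^sub>L op_exp (t *\<^sub>R z)) o\<^sub>L b)) o\<^sub>L op_exp (- t *\<^sub>R z))
      = delta (orbit_curve b z t) z"
    using op_exp_commute_apply[of "- t" z]
    by (intro blinfun_eqI)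
      (simp add: delta_def orbit_curve_def blinfun.add_left blinfun.diff_left blinfun.minus_left
        blinfun.minus_right blinfun.zero_right)
  ultimately show ?thesis by simp
qed

text \<open>The generator \<open>z\<close> lifts every velocity of its orbit curve, so \<open>\<parallel>z\<parallel>\<close> bounds the Finsler speed.\<close>

lemma curve_length_orbit_curve_le:
  assumes z: "z \<in> compact_ah" and ab: "a \<le> b"
  shows "curve_length a b (orbit_curve c z) \<le> (b - a) * norm z"
proof (cases "a = b")
  case False
  let ?F = "\<lambda>t. finsler_norm (orbit_curve c z t) (vector_derivative (orbit_curve c z) (at t within {a..b}))"
  have le: "?F t \<le> norm z" if "t \<in> {a..b}" for t
  proof -
    have "vector_derivative (orbit_curve c z) (at t within {a..b}) = delta (orbit_curve c z t) z"
      using vector_derivative_within_cbox[of a b t "orbit_curve c z" "delta (orbit_curve c z t) z"]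
        orbit_curve_has_vector_derivative[of c z t "{a..b}"] that ab False by simp
    then show ?thesis by (simp add: finsler_norm_le z)
  qed
  show ?thesis
  proof (cases "?F integrable_on {a..b}")
    case True
    have "integral {a..b} ?F \<le> integral {a..b} (\<lambda>t. norm z)"
      using True le by (intro integral_le) auto
    then show ?thesis using ab by (simp add: curve_length_def)
  next
    case False
    \<comment> \<open>by convention the integral is then zero\<close>
    then show ?thesis using ab by (simp add: curve_length_def not_integrable_integral)
  qed
qed (simp add: curve_length_def)

text \<open>With a norm-attaining unit vector \<open>y\<close> of \<open>z\<close>, the vectors \<open>(\<beta> s - \<beta> s\<^sup>*) \<eta>\<close> for \<open>\<eta> = - J y\<close> run on the unit
  sphere from \<open>y\<close> to \<open>exp (2 t z) y\<close>. The angle between these is \<open>2 \<bar>t\<bar> \<parallel>z\<parallel>\<close>, as this number does not exceed \<open>\<pi>\<close>,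
  and the path has at most twice the length of \<open>\<beta>\<close>.\<close>

lemma orbit_curve_minimal:
  fixes b z :: "('a::complex_hilbert_space \<times> 'a) \<Rightarrow>\<^sub>L ('a \<times> 'a)"
  assumes b: "b \<in> orbit_N" and z: "z \<in> compact_ah"
    and anti: "\<And>v. z ((b - hilbert_adj b) v) = - (b - hilbert_adj b) (z v)"
    and small: "\<bar>t\<bar> * norm z \<le> pi / 2"
    and pw: "piecewise_smooth_curve_on c d \<beta>"
    and orb: "\<And>s. s \<in> {c..d} \<Longrightarrow> \<beta> s \<in> orbit_N"
    and ends: "\<beta> c = b" "\<beta> d = orbit_curve b z t"
  shows "\<bar>t\<bar> * norm z \<le> curve_length c d \<beta>"
proof -
  let ?J = "b - hilbert_adj b" and ?E = "op_exp (t *\<^sub>R z)"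
  have skew: "hilbert_adj z = - z" using z by (simp add: compact_ah_iff)
  have unit: "matrix_unit b" by (rule orbit_N_matrix_unit[OF b])
  have unit_d: "matrix_unit (orbit_curve b z t)"
    by (rule orbit_N_matrix_unit[OF orbit_curve_in_orbit[OF b z]])
  have abs_inner_le: "\<bar>inner v ((a - hilbert_adj a) w)\<bar> \<le> 1"
    if "matrix_unit a" "norm v = 1" "norm w = 1" for a :: "('a \<times> 'a) \<Rightarrow>\<^sub>L ('a \<times> 'a)" and v w
    using Cauchy_Schwarz_ineq2[of v "(a - hilbert_adj a) w"] that
    by (simp add: norm_matrix_unit_skew)
  show ?thesis
  proof (cases "z = 0")
    case True
    \<comment> \<open>that lengths are non-negative follows from the angle estimate for any unit vector; one exists because a
      curve with non-vanishing derivative cannot live in the zero space\<close>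
    obtain n :: nat and p :: "nat \<Rightarrow> real" where "0 < n" "\<forall>i<n. smooth_curve_on (p i) (p (Suc i)) \<beta>"
      using pw unfolding piecewise_smooth_curve_on_def by blast
    then have "smooth_curve_on (p 0) (p (Suc 0)) \<beta>" by blast
    then obtain w where "p 0 < p (Suc 0)" "\<forall>s\<in>{p 0..p (Suc 0)}. w s \<noteq> (0 :: ('a \<times> 'a) \<Rightarrow>\<^sub>L ('a \<times> 'a))"
      unfolding smooth_curve_on_def by blast
    then have "w (p 0) \<noteq> 0" by simp
    then obtain v where "w (p 0) v \<noteq> 0"
      by (metis blinfun_eqI blinfun.zero_left)
    then have "v \<noteq> 0" by auto
    then have "norm ((1 / norm v) *\<^sub>R v) = 1" by simp
    then obtain y :: "'a \<times> 'a" where y: "norm y = 1" by blast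
    have "\<bar>arccos (inner y ((\<beta> d - hilbert_adj (\<beta> d)) y)) - arccos (inner y ((\<beta> c - hilbert_adj (\<beta> c)) y))\<bar>
        \<le> 2 * curve_length c d \<beta>"
      unfolding ends
      by (rule angle_le_length[OF pw orb y y, where f="\<lambda>s. inner y ((\<beta> s - hilbert_adj (\<beta> s)) y)",
            unfolded ends]) (simp_all add: abs_inner_le unit unit_d y)
    then show ?thesis using True by simp
  next
    case False
    then obtain y where y: "norm y = 1" "z (z y) = - (norm z)\<^sup>2 *\<^sub>R y"
      using compact_skew_maximal_vector[OF z] by metis
    have m: "norm z > 0" using False by simp
    let ?f = "\<lambda>s. inner y ((\<beta> s - hilbert_adj (\<beta> s)) (- ?J y))"
    have norm_J: "norm (- ?J y) = 1"
      unfolding norm_minus_cancel by (simp only: norm_matrix_unit_skew[OF unit] y)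
    have JJ: "?J (- ?J y) = y"
      by (simp only: blinfun.minus_right matrix_unit_skew_apply[OF unit] minus_minus)
    have f_c: "?f c = 1"
      using y(1) unfolding ends JJ by (simp add: norm_eq_sqrt_inner)
    have "(orbit_curve b z t - hilbert_adj (orbit_curve b z t)) v = ?E (?J (op_exp (- t *\<^sub>R z) v))" for v
      using hilbert_adj_op_exp[OF skew, of t] hilbert_adj_op_exp[OF skew, of "- t"]
      by (simp add: orbit_curve_def hilbert_adj_compose blinfun.diff_left blinfun.diff_right)
    then have f_d: "?f d = cos (2 * (norm z * t))"
      unfolding ends op_exp_anticommute[OF anti]
      by (simp only: JJ inner_op_exp_maximal_vector[OF skew m y(2,1)])
    have "\<bar>arccos (?f d) - arccos (?f c)\<bar> \<le> 2 * curve_length c d \<beta>"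
      by (rule angle_le_length[OF pw orb y(1) norm_J]) (simp_all only: f_c f_d, simp_all)
    moreover have "arccos (cos (2 * (norm z * t))) = \<bar>2 * (norm z * t)\<bar>"
      using small by (intro arccos_cos_eq_abs) (simp add: abs_mult mult_ac)
    ultimately show ?thesis
      unfolding f_c f_d by (simp add: abs_mult mult.commute)
  qed
qed

theorem theorem7p4:
  fixes b x :: "('a::complex_hilbert_space \<times> 'a) \<Rightarrow>\<^sub>L ('a \<times> 'a)"
  assumes "b \<in> orbit_N"
    and "x \<in> tangent_space b"
    and "antisymmetric_at b x"
    and "finsler_norm b x < pi / 2"
  shows "\<exists>z0 \<gamma>. minimal_lifting b x z0 \<and>
    \<gamma> = (\<lambda>t::real. op_exp (t *\<^sub>R z0) o\<^sub>L b o\<^sub>L op_exp (- t *\<^sub>R z0)) \<and>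
    (\<forall>t. \<gamma> t \<in> orbit_N) \<and>
    \<gamma> 0 = b \<and>
    (\<gamma> has_vector_derivative x) (at 0) \<and>
    (\<forall>t0. \<bar>t0\<bar> \<le> 1 \<longrightarrow>
      (\<forall>c d \<beta>. piecewise_smooth_curve_on c d \<beta> \<and> (\<forall>t\<in>{c..d}. \<beta> t \<in> orbit_N) \<and>
          \<beta> c = b \<and> \<beta> d = \<gamma> t0 \<longrightarrow>
        curve_length (min 0 t0) (max 0 t0) \<gamma> \<le> curve_length c d \<beta>))"
proof -
  obtain z where z: "z \<in> compact_ah" "delta b z = x"
    and anti: "\<And>v. z ((b - hilbert_adj b) v) = - (b - hilbert_adj b) (z v)"
    using antisymmetric_anticommuting_lifting[OF assms(3)] by blast
  have min: "minimal_lifting b x z"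
    using anticommuting_lifting_minimal[OF orbit_N_matrix_unit[OF assms(1)] z(1) anti] z(2) by simp
  have curve: "orbit_curve b z = (\<lambda>t. op_exp (t *\<^sub>R z) o\<^sub>L b o\<^sub>L op_exp (- t *\<^sub>R z))"
    by (rule ext) (simp add: orbit_curve_def)
  have deriv: "(orbit_curve b z has_vector_derivative x) (at 0)"
    using orbit_curve_has_vector_derivative[of b z 0 UNIV] z(2) by (simp add: orbit_curve_zero)
  have "curve_length (min 0 t0) (max 0 t0) (orbit_curve b z) \<le> curve_length c d \<beta>"
    if t0: "\<bar>t0\<bar> \<le> 1" and \<beta>: "piecewise_smooth_curve_on c d \<beta>" "\<forall>t\<in>{c..d}. \<beta> t \<in> orbit_N"
      "\<beta> c = b" "\<beta> d = orbit_curve b z t0" for t0 c d \<beta>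
  proof -
    have "curve_length (min 0 t0) (max 0 t0) (orbit_curve b z) \<le> (max 0 t0 - min 0 t0) * norm z"
      by (rule curve_length_orbit_curve_le[OF z(1)]) simp
    also have "max 0 t0 - min 0 t0 = \<bar>t0\<bar>" by simp
    also have "\<bar>t0\<bar> * norm z \<le> curve_length c d \<beta>"
    proof (rule orbit_curve_minimal[OF assms(1) z(1) anti _ \<beta>(1) \<beta>(2)[rule_format] \<beta>(3,4)])
      have "\<bar>t0\<bar> * norm z \<le> 1 * norm z"
        using t0 by (intro mult_right_mono) auto
      then show "\<bar>t0\<bar> * norm z \<le> pi / 2"
        using min assms(4) by (simp add: minimal_lifting_def)
    qed
    finally show ?thesis .
  qed
  then show ?thesis
    using min orbit_curve_in_orbit[OF assms(1) z(1)] orbit_curve_zero[of b z] deriv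
    by (intro exI[of _ z] exI[of _ "orbit_curve b z"]) (use curve in auto)
qed

end
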